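(* For every fixed integer $m$, one has $N_{C_1}(m,n)>0$ for all large enough integers $n$ (i.e. there is $n_0=n_0(m)$ such that $N_{C_1}(m,n)>0$ for all integers $n\ge n_0$).
   Context: For $n\in\{0,1,2,\dots\}\cup\{\infty\}$ put $(a;q)_n:=\prod_{k=1}^{n}(1-aq^{k-1})$ and $(a)_n:=(a;q)_n$. The integers $N_{C_1}(m,n)$ ($m\in\mathbb{Z}$, $n\ge 0$) are defined by the generating function $$\sum_{n\ge 0}\sum_{m\in\mathbb{Z}}N_{C_1}(m,n)z^mq^n=\frac{(q;q^2)_\infty (q)_\infty}{(z)_\infty(z^{-1})_\infty}\sum_{n=1}^{\infty}\frac{q^n(z)_n(z^{-1})_n}{(q;q^2)_n(q)_n},$$ where, for each $n\geq 1$, the quotient $\frac{(z)_n(z^{-1})_n}{(z)_\infty(z^{-1})_\infty}$ is understood as $\frac{1}{(zq^n)_\infty(z^{-1}q^n)_\infty}$, expanded as a power series in $q$ with coefficients Laurent polynomials in $z$. *)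

theory Defs
  imports
    "HOL-Analysis.Analysis"
    "HOL-Computational_Algebra.Formal_Power_Series"
    "HOL-Library.Poly_Mapping"
begin

text \<open>
  A Laurent polynomial in \<open>z\<close> with integer coefficients is a finitely supported map from exponents
  to coefficients, multiplied by convolution. The generating function lives in the ring of formal
  power series in \<open>q\<close> over these; infinite products and sums are limits in the \<open>q\<close>-adic metric.
\<close>

type_synonym int_laurent = "int \<Rightarrow>\<^sub>0 int"

abbreviation qq :: "int_laurent fps" where
  "qq \<equiv> fps_X"

definition zz :: "int_laurent fps" where
  "zz = fps_const (Poly_Mapping.single 1 1)"

definition zz_inv :: "int_laurent fps" where
  "zz_inv = fps_const (Poly_Mapping.single (-1) 1)"

definition qpoch :: "'a::comm_ring_1 fps \<Rightarrow> 'a fps \<Rightarrow> nat \<Rightarrow> 'a fps" where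
  "qpoch a q n = (\<Prod>k=1..n. 1 - a * q ^ (k - 1))"

definition qpoch_inf :: "'a::comm_ring_1 fps \<Rightarrow> 'a fps \<Rightarrow> 'a fps" where
  "qpoch_inf a q = prodinf (\<lambda>k. 1 - a * q ^ k)"

text \<open>
  The coefficients do not form a field, so \<open>inverse\<close> is unavailable. A series with constant
  coefficient 1 nevertheless has a reciprocal; its recursion starts from the value 1.
\<close>

definition fps_recip :: "'a::comm_ring_1 fps \<Rightarrow> 'a fps" where
  "fps_recip f = fps_left_inverse f 1"

text \<open>
  In the \<open>n\<close>-th summand \<open>(z)\<^sub>n (1/z)\<^sub>n / ((z)\<^sub>\<infinity> (1/z)\<^sub>\<infinity>)\<close> is read as
  \<open>1 / ((z q\<^sup>n)\<^sub>\<infinity> (q\<^sup>n/z)\<^sub>\<infinity>)\<close>; the series \<open>(z)\<^sub>\<infinity>\<close> itself has constant coefficient \<open>1 - z\<close>,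
  which is not a unit.
\<close>

definition C1_term :: "nat \<Rightarrow> int_laurent fps" where
  "C1_term n =
     qq ^ n * (fps_recip (qpoch_inf (zz * qq ^ n) qq) * fps_recip (qpoch_inf (zz_inv * qq ^ n) qq))
       * fps_recip (qpoch qq (qq ^ 2) n * qpoch qq qq n)"

definition C1_gf :: "int_laurent fps" where
  "C1_gf = qpoch_inf qq (qq ^ 2) * qpoch_inf qq qq * suminf (\<lambda>n. C1_term (Suc n))"

definition N_C1 :: "int \<Rightarrow> nat \<Rightarrow> int" where
  "N_C1 m n = Poly_Mapping.lookup (fps_nth C1_gf n) m"


text \<open>All the limits and reciprocals above exist.\<close>

lemma zz_mult_zz_inv: "zz * zz_inv = 1"
  by (simp add: zz_def zz_inv_def Poly_Mapping.mult_single)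

lemma fps_mult_recip:
  assumes "fps_nth f 0 = 1"
  shows "f * fps_recip f = 1"
  unfolding fps_recip_def using assms by (intro fps_right_inverse') simp_all

lemma LIMSEQ_fps_of_stable:
  fixes S :: "nat \<Rightarrow> 'a::group_add fps"
  assumes "\<And>m n. m \<le> n \<Longrightarrow> fps_nth (S (Suc n)) m = fps_nth (S n) m"
  shows "S \<longlonglongrightarrow> Abs_fps (\<lambda>m. fps_nth (S m) m)"
proof (rule tendsto_fpsI)
  fix m
  have "fps_nth (S n) m = fps_nth (S m) m" if "m \<le> n" for n
    using that by (induction n rule: dec_induct) (simp_all add: assms)
  then show "\<forall>\<^sub>F n in sequentially. fps_nth (S n) m = fps_nth (Abs_fps (\<lambda>m. fps_nth (S m) m)) m"
    unfolding eventually_sequentially fps_nth_Abs_fps by blast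
qed

lemma qpoch_inf_has_prod:
  fixes a :: "'a::idom fps"
  assumes a: "fps_nth a 0 = 0" and d: "d > 0"
  shows "(\<lambda>k. 1 - a * (fps_X ^ d) ^ k) has_prod qpoch_inf a (fps_X ^ d)"
    and "fps_nth (qpoch_inf a (fps_X ^ d)) 0 = 1"
proof -
  define P where "P n = (\<Prod>k\<le>n. 1 - a * (fps_X ^ d) ^ k)" for n
  define p where "p = Abs_fps (\<lambda>m. fps_nth (P m) m)"
  have "fps_nth (P (Suc n)) m = fps_nth (P n) m" if "m \<le> n" for m n
  proof -
    have "P (Suc n) = P n - (P n * a) * fps_X ^ (d * Suc n)"
      unfolding P_def prod.atMost_Suc power_mult by (simp only: right_diff_distrib mult_1_right mult.assoc)
    moreover have "m < d * Suc n"
      using that mult_le_mono1[of 1 d "Suc n"] d by simp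
    ultimately show ?thesis
      by (simp add: fps_X_power_mult_right_nth)
  qed
  then have "P \<longlonglongrightarrow> p"
    unfolding p_def by (rule LIMSEQ_fps_of_stable)
  moreover have p0: "fps_nth p 0 = 1"
    using a by (simp add: p_def P_def)
  moreover from p0 have "p \<noteq> 0"
    by auto
  ultimately have "(\<lambda>k. 1 - a * (fps_X ^ d) ^ k) has_prod p"
    unfolding has_prod_def raw_has_prod_def P_def by simp
  moreover from this have "qpoch_inf a (fps_X ^ d) = p"
    unfolding qpoch_inf_def by (rule has_prod_unique[symmetric])
  ultimately show "(\<lambda>k. 1 - a * (fps_X ^ d) ^ k) has_prod qpoch_inf a (fps_X ^ d)"
    and "fps_nth (qpoch_inf a (fps_X ^ d)) 0 = 1"
    using p0 by simp_all
qed

lemma C1_denominators_nth_0: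
  assumes "n > 0"
  shows "fps_nth (qpoch_inf (zz * qq ^ n) qq) 0 = 1"
    and "fps_nth (qpoch_inf (zz_inv * qq ^ n) qq) 0 = 1"
    and "fps_nth (qpoch qq (qq ^ 2) n * qpoch qq qq n) 0 = 1"
proof -
  show "fps_nth (qpoch_inf (zz * qq ^ n) qq) 0 = 1"
    using qpoch_inf_has_prod(2)[of "zz * qq ^ n" 1] assms by simp
  show "fps_nth (qpoch_inf (zz_inv * qq ^ n) qq) 0 = 1"
    using qpoch_inf_has_prod(2)[of "zz_inv * qq ^ n" 1] assms by simp
  have "fps_nth (qpoch qq r n) 0 = 1" for r :: "int_laurent fps"
    unfolding qpoch_def by (induction n) simp_all
  then show "fps_nth (qpoch qq (qq ^ 2) n * qpoch qq qq n) 0 = 1"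
    by simp
qed

lemma summable_C1_term: "summable (\<lambda>n. C1_term (Suc n))"
proof -
  have *: "fps_nth (C1_term n) m = 0" if "m < n" for m n
    using that by (simp add: C1_term_def mult.assoc fps_X_power_mult_nth)
  have "(\<lambda>n. \<Sum>i<n. C1_term (Suc i)) \<longlonglongrightarrow>
          Abs_fps (\<lambda>m. fps_nth (\<Sum>i<m. C1_term (Suc i)) m)"
    by (rule LIMSEQ_fps_of_stable) (simp add: *)
  then show ?thesis
    unfolding summable_def sums_def by blast
qed

end

theory Submission
  imports Defs "HOL-Computational_Algebra.Polynomial_Factorial"
begin

text \<open>
  Write \<open>b(n,r) = 1/((q)\<^sub>n\<^sub>-\<^sub>r (q)\<^sub>n\<^sub>+\<^sub>r)\<close>. The generating function is a sum over \<open>n \<ge> 1\<close> of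
  \<open>q\<^sup>n/((zq\<^sup>n)\<^sub>\<infinity> (q\<^sup>n/z)\<^sub>\<infinity>)\<close> against the weights \<open>\<beta>\<^sub>n = 1/((q;q\<^sup>2)\<^sub>n (q)\<^sub>n)\<close>, and Bailey's method
  evaluates it. The weights are expanded as \<open>\<beta>\<^sub>n = \<Sum>\<^sub>r \<alpha>\<^sub>r b(n,r)\<close> over \<open>1 \<le> r \<le> n\<close>
  (\<open>bailey_pair\<close>): here \<open>\<alpha>\<close> is Slater's sequence C(1) minus the sequence of the unit Bailey pair.
  Both sequences start with 1, so the difference has no term \<open>r = 0\<close>, which would bring in the
  denominator \<open>(1 - z)(1 - 1/z)\<close>; and the unit pair contributes nothing to \<open>\<beta>\<^sub>n\<close> when \<open>n \<ge> 1\<close>.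
  For fixed \<open>r\<close>, the sum over \<open>n\<close> telescopes (\<open>conjugate_bailey_sum\<close>), with limit
  \<open>q\<^sup>r/((1 - zq\<^sup>r)(1 - q\<^sup>r/z))\<close> divided by the square of \<open>(q)\<^sub>\<infinity>\<close>. Since
  \<open>(q;q\<^sup>2)\<^sub>\<infinity> (q\<^sup>2;q\<^sup>2)\<^sub>\<infinity> = (q)\<^sub>\<infinity>\<close>, multiplying the generating function by \<open>(q\<^sup>2;q\<^sup>2)\<^sub>\<infinity>\<close> leaves
  \<open>\<Sum>\<^sub>r \<alpha>\<^sub>r q\<^sup>r/((1 - zq\<^sup>r)(1 - q\<^sup>r/z))\<close>, in which the coefficient of \<open>z\<^sup>m\<close> can be read off
  (\<open>zcoeff_C1_gf_cong\<close>).

  With \<open>m \<ge> 0\<close> (the other case is symmetric) that coefficient is \<open>F = \<Sum>\<^sub>r \<alpha>\<^sub>r q\<^sup>r\<^sup>(\<^sup>m\<^sup>+\<^sup>1\<^sup>)/(1 - q\<^sup>2\<^sup>r)\<close>, a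
  signed combination of geometric progressions whose steps are indices \<open>r\<close> or their doubles. For odd
  \<open>r\<close>, the progressions with steps \<open>r\<close> and \<open>2r\<close> start at exponents that agree modulo \<open>r\<close>; after splitting
  by the parity of the exponents, the negative ones only cut off the tails of the positive ones, and
  what survives is a finite progression of positive terms with odd exponents and one with even
  exponents. For even \<open>r\<close>, the progressions with step \<open>2r\<close> leave a finite progression of negative
  terms, all with even exponents. The negative terms with step \<open>2(2i + 2)\<close> can be matched with positive
  even terms with step \<open>2(2i + 1)\<close> and smaller exponents, and a matched pair \<open>q\<^sup>2\<^sup>s - q\<^sup>2\<^sup>t\<close> is
  \<open>1 - q\<^sup>2\<close> times a polynomial with nonnegative coefficients
  (\<open>three_terms_decomposition\<close>). So \<open>F = P + (1 - q\<^sup>2) Q\<close> with \<open>P\<close> and \<open>Q\<close> nonnegative. Dividing by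
  \<open>(q\<^sup>2;q\<^sup>2)\<^sub>\<infinity>\<close> keeps both parts nonnegative, because this product contains the factor \<open>1 - q\<^sup>2\<close>. The
  first terms of \<open>P\<close> and \<open>Q\<close> then yield a positive coefficient at every odd and every even exponent
  from \<open>\<bar>m\<bar> + 2\<close> on (\<open>N_C1_pos\<close>).

  The infinite products and the infinite sum are handled modulo powers of \<open>q\<close>: each coefficient of
  the generating function depends on finitely many factors and terms.
\<close>


section \<open>Sums over integer intervals\<close>

lemma sum_symmetric_interval:
  fixes f :: "int \<Rightarrow> 'a::comm_monoid_add"
  shows "(\<Sum>j=-int n..int n. f j) = f 0 + (\<Sum>j=1..n. f (int j) + f (- int j))"
proof (induction n)
  case (Suc n)
  have "{-int (Suc n)..int (Suc n)} = insert (int (Suc n)) (insert (- int (Suc n)) {-int n..int n})"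
    by auto
  then show ?case
    by (simp add: Suc.IH ac_simps)
qed simp

lemma sum_reflect_interval:
  fixes f :: "int \<Rightarrow> 'a::comm_monoid_add"
  shows "(\<Sum>j=a..b. f j) = (\<Sum>j=c-b..c-a. f (c - j))"
  by (rule sum.reindex_bij_witness[of _ "\<lambda>j. c - j" "\<lambda>j. c - j"]) auto

lemma sum_pairs:
  fixes f :: "nat \<Rightarrow> 'a::comm_monoid_add"
  shows "(\<Sum>r=1..2*n. f r) = (\<Sum>i<n. f (2 * i + 1) + f (2 * i + 2))"
  by (induction n) (simp_all add: ac_simps)

lemma sum_mult_add_mult:
  fixes x r :: "'a::comm_ring_1"
  shows "(\<Sum>j\<in>S. x * (f j + r * g j)) = x * (sum f S + r * sum g S)"
  by (simp add: sum_distrib_left sum.distrib distrib_left)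

lemma sum_antisymmetric:
  fixes f :: "int \<Rightarrow> 'a::field"
  assumes "(2 :: 'a) \<noteq> 0" and "\<And>j. j \<in> {a..b} \<Longrightarrow> f (a + b - j) = - f j"
  shows "(\<Sum>j=a..b. f j) = 0"
proof -
  have "(\<Sum>j=a..b. f j) = (\<Sum>j=a..b. f (a + b - j))"
    using sum_reflect_interval[of f a b "a + b"] by simp
  also have "\<dots> = - (\<Sum>j=a..b. f j)"
    by (simp add: assms sum_negf)
  finally have "2 * (\<Sum>j=a..b. f j) = 0"
    by (simp only: mult_2 eq_neg_iff_add_eq_0)
  then show ?thesis
    using assms(1) by simp
qed

section \<open>The Bailey pair\<close>

definition qfact :: "'a::comm_ring_1 \<Rightarrow> nat \<Rightarrow> 'a" where
  "qfact q n = (\<Prod>k=1..n. 1 - q ^ k)"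

definition odd_qpoch :: "'a::comm_ring_1 \<Rightarrow> nat \<Rightarrow> 'a" where
  "odd_qpoch q n = (\<Prod>k=1..n. 1 - q ^ (2 * k - 1))"

text \<open>
  The sequence of the unit Bailey pair, for which \<open>\<Sum>\<^sub>r \<alpha>\<^sub>r b(n,r)\<close> is 0 for every \<open>n \<ge> 1\<close>. The value at
  0 in such a pair is 1; this formula is meant for \<open>r \<ge> 1\<close>, where it combines the contributions of the
  integers \<open>r\<close> and \<open>-r\<close>.
\<close>
definition bailey_alpha_unit :: "'a::comm_ring_1 \<Rightarrow> nat \<Rightarrow> 'a" where
  "bailey_alpha_unit q r = (-1) ^ r * q ^ (r * (r - 1) div 2) * (1 + q ^ r)"

text \<open>
  Slater's sequence C(1): at \<open>r = 2j\<close> it is \<open>(-1)\<^sup>j q\<close> to the power \<open>3j\<^sup>2 - j\<close>, times \<open>1 + q\<^sup>2\<^sup>j\<close>. Again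
  \<open>r \<ge> 1\<close> is intended.
\<close>
definition bailey_alpha_C1 :: "'a::comm_ring_1 \<Rightarrow> nat \<Rightarrow> 'a" where
  "bailey_alpha_C1 q r =
     (if even r then (-1) ^ (r div 2) * q ^ (r div 2 * (3 * (r div 2) - 1)) * (1 + q ^ r) else 0)"

definition bailey_alpha :: "'a::comm_ring_1 \<Rightarrow> nat \<Rightarrow> 'a" where
  "bailey_alpha q r = bailey_alpha_C1 q r - bailey_alpha_unit q r"

text \<open>
  The convention \<open>1/(q)\<^sub>k = 0\<close> for \<open>k < 0\<close> makes the recurrence in \<open>k\<close> hold for all integers, so that
  sums over \<open>r\<close> need no boundary terms.
\<close>
definition inv_qfact :: "'a::field \<Rightarrow> int \<Rightarrow> 'a" where
  "inv_qfact q k = (if k < 0 then 0 else inverse (qfact q (nat k)))"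

lemma minus_one_powi_one_minus: "(-1 :: 'a::field) powi (1 - r) = - ((-1) powi r)"
  by (simp add: power_int_diff power_int_minus_one_minus divide_inverse flip: power_int_minus)

text \<open>
  With \<open>x = q\<^sup>n\<close>, \<open>y = q\<^sup>2\<^sup>j\<close> and \<open>p = 1/q\<close>, this writes the summand of the recurrence for the C(1) sum as
  a combination of the two summands whose sums vanish by symmetry.
\<close>
lemma C1_recurrence_certificate:
  fixes x y y' p u v :: "'a::field"
  assumes "y * y' = 1"
  shows "(1 - x) * (1 - x * x * p) * (u * v) - u * ((1 - x * y') * (1 - x * y) * v) =
     x * (u * y * ((1 - x * y') * (1 - x * y' * p) * v) + (1 - x * x * p) * (u * (y' - 1) * v))"
  using assms by algebra

context
  fixes q :: "'a::field"
  assumes two_nonzero: "(2 :: 'a) \<noteq> 0" and q_nonzero: "q \<noteq> 0" and q_not_root: "\<And>n::nat. n > 0 \<Longrightarrow> q ^ n \<noteq> 1"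
begin

lemma inv_qfact_pred: "inv_qfact q (k - 1) = (1 - q powi k) * inv_qfact q k"
proof (cases "k > 0")
  case True
  define n where "n = nat (k - 1)"
  have k: "k = int (Suc n)" using True by (simp add: n_def)
  have "qfact q (Suc n) = qfact q n * (1 - q ^ Suc n)"
    by (simp add: qfact_def)
  moreover have "1 - q ^ Suc n \<noteq> 0"
    using q_not_root[of "Suc n"] by (metis eq_iff_diff_eq_0 zero_less_Suc)
  ultimately show ?thesis
    unfolding k by (simp add: inv_qfact_def nat_add_distrib power_int_def del: power_Suc)
qed (auto simp: inv_qfact_def)

definition bailey_kernel :: "int \<Rightarrow> int \<Rightarrow> 'a" where
  "bailey_kernel n r = inv_qfact q (n - r) * inv_qfact q (n + r)"

lemma bailey_kernel_minus [simp]: "bailey_kernel n (- r) = bailey_kernel n r"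
  by (simp add: bailey_kernel_def mult.commute)

lemma bailey_kernel_eq_0: "\<bar>r\<bar> > n \<Longrightarrow> bailey_kernel n r = 0"
  by (auto simp: bailey_kernel_def inv_qfact_def)

lemma bailey_kernel_pred: "bailey_kernel (n - 1) r = (1 - q powi (n - r)) * (1 - q powi (n + r)) * bailey_kernel n r"
proof -
  have "n - 1 - r = (n - r) - 1" "n - 1 + r = (n + r) - 1"
    by simp_all
  then show ?thesis
    unfolding bailey_kernel_def by (simp only: inv_qfact_pred mult_ac)
qed

lemma bailey_kernel_pred_Suc: "bailey_kernel (n - 1) (r + 1) = (1 - q powi (n - r)) * (1 - q powi (n - r - 1)) * bailey_kernel n r"
proof -
  have "n - 1 - (r + 1) = (n - r - 1) - 1" "n - 1 + (r + 1) = n + r"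
    by simp_all
  then show ?thesis
    unfolding bailey_kernel_def by (simp only: inv_qfact_pred mult_ac)
qed

text \<open>
  The sum \<open>S\<close> is invariant under \<open>r \<mapsto> -r\<close>, which multiplies its coefficients by \<open>q\<^sup>r\<close>. Hence
  \<open>(1 - q\<^sup>n) S\<close> is the sum with \<open>b(n,r)\<close> replaced by \<open>(1 - q\<^sup>n\<^sup>+\<^sup>r) b(n,r)\<close>, that is, by
  \<open>1/((q)\<^sub>n\<^sub>-\<^sub>r (q)\<^sub>n\<^sub>+\<^sub>r\<^sub>-\<^sub>1)\<close>. This is symmetric under \<open>r \<mapsto> 1 - r\<close> while the coefficients change sign.
\<close>
lemma unit_bailey_pair_int:
  assumes "n > 0"
  shows "(\<Sum>r=-int n..int n. (-1) powi r * q powi (r * (r - 1) div 2) * bailey_kernel (int n) r) = 0"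
proof -
  define c where "c r = (-1 :: 'a) powi r * q powi (r * (r - 1) div 2)" for r :: int
  have c_reflect: "c (1 - r) = - c r" for r
  proof -
    have "(1 - r) * (1 - r - 1) = r * (r - 1)"
      by (simp add: algebra_simps)
    then show ?thesis
      by (simp add: c_def minus_one_powi_one_minus)
  qed
  have c_minus: "c (- r) = c r * q powi r" for r
  proof -
    have "(-r) * (-r - 1) div 2 = r * (r - 1) div 2 + r"
      by (simp add: algebra_simps)
    then show ?thesis
      using q_nonzero unfolding c_def
      by (simp only: power_int_minus_one_minus power_int_add simp_thms mult.assoc)
  qed
  define S where "S = (\<Sum>r=-int n..int n. c r * bailey_kernel (int n) r)"
  have "S = (\<Sum>r=-int n..int n. c r * q powi r * bailey_kernel (int n) r)"
    unfolding S_def using sum_reflect_interval[of "\<lambda>r. c r * bailey_kernel (int n) r" "-int n" "int n" 0]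
    by (simp add: c_minus)
  then have "S - q ^ n * S = (\<Sum>r=-int n..int n. c r * bailey_kernel (int n) r - q ^ n * (c r * q powi r * bailey_kernel (int n) r))"
    by (simp add: S_def sum_distrib_left sum_subtractf)
  also have "\<dots> = (\<Sum>r=-int n..int n. c r * (inv_qfact q (int n - r) * inv_qfact q (int n + r - 1)))"
    using q_nonzero by (simp add: inv_qfact_pred bailey_kernel_def power_int_add algebra_simps)
  also have "\<dots> = (\<Sum>r=1-int n..int n. c r * (inv_qfact q (int n - r) * inv_qfact q (int n + r - 1)))"
    by (rule sum.mono_neutral_right) (auto simp: inv_qfact_def)
  also have "\<dots> = 0"
    by (rule sum_antisymmetric[OF two_nonzero]) (simp add: c_reflect algebra_simps)
  finally have "(1 - q ^ n) * S = 0"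
    by (simp add: algebra_simps)
  then show ?thesis
    using q_not_root[OF assms] unfolding S_def c_def by simp
qed

definition C1_sum :: "nat \<Rightarrow> 'a" where
  "C1_sum n = (\<Sum>j=-int n..int n. (-1) powi j * q powi (3 * j\<^sup>2 + j) * bailey_kernel (int n) (2 * j))"

text \<open>
  The difference of the two sides is \<open>q\<^sup>n (A + (1 - q\<^sup>2\<^sup>n\<^sup>-\<^sup>1) B)\<close> for two sums \<open>A\<close> and \<open>B\<close>, of which \<open>A\<close>
  vanishes by antisymmetry under \<open>j \<mapsto> -1 - j\<close> and \<open>B\<close> by the symmetry \<open>j \<mapsto> -j\<close>.
\<close>
lemma C1_sum_rec:
  assumes "n > 0"
  shows "(1 - q ^ n) * (1 - q ^ (2 * n - 1)) * C1_sum n = C1_sum (n - 1)"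
proof -
  define c where "c j = (-1 :: 'a) powi j * q powi (3 * j\<^sup>2 + j)" for j :: int
  define N where "N = int n"
  define b where "b j = bailey_kernel N (2 * j)" for j
  have "2 * N - 1 = int (2 * n - 1)"
    using assms by (simp add: N_def of_nat_diff)
  then have npow: "q ^ n = q powi N" "q ^ (2 * n - 1) = q powi (2 * N - 1)"
    by (simp_all only: N_def power_int_of_nat)
  \<comment> \<open>\<open>A\<close> is the sum of \<open>(-1)\<^sup>j q\<close> to the power \<open>3j(j+1)\<close> times \<open>b(n-1,2j+1)\<close>. The substitution
    \<open>j \<mapsto> -1 - j\<close> changes only the sign \<open>(-1)\<^sup>j\<close>.\<close>
  define A where "A = (\<Sum>j=-N..N. c j * q powi (2 * j) * bailey_kernel (N - 1) (2 * j + 1))"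
  define B where "B = (\<Sum>j=-N..N. c j * (q powi (- 2 * j) - 1) * b j)"
  have "A = (\<Sum>j=-N..N-1. c j * q powi (2 * j) * bailey_kernel (N - 1) (2 * j + 1))"
    unfolding A_def by (rule sum.mono_neutral_right) (auto intro!: bailey_kernel_eq_0 simp: N_def)
  also have "\<dots> = 0"
  proof (rule sum_antisymmetric[OF two_nonzero])
    fix j assume "j \<in> {-N..N-1}"
    have "bailey_kernel (N - 1) (2 * (-1 - j) + 1) = bailey_kernel (N - 1) (2 * j + 1)"
      using bailey_kernel_minus[of "N - 1" "2 * j + 1"] by (simp add: algebra_simps)
    moreover have "c (-1 - j) * q powi (2 * (-1 - j)) = - (c j * q powi (2 * j))"
    proof -
      have "3 * (-1 - j)\<^sup>2 + (-1 - j) + 2 * (-1 - j) = 3 * j\<^sup>2 + j + 2 * j"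
        by (simp add: power2_eq_square algebra_simps)
      then have "q powi (3 * (-1 - j)\<^sup>2 + (-1 - j)) * q powi (2 * (-1 - j)) = q powi (3 * j\<^sup>2 + j) * q powi (2 * j)"
        using q_nonzero by (metis power_int_add)
      moreover have "(-1 :: 'a) powi (-1 - j) = - ((-1) powi j)"
        using minus_one_powi_one_minus[of "j + 2", where 'a = 'a]
        by (simp add: power_int_add algebra_simps)
      ultimately show ?thesis
        unfolding c_def by (simp add: mult.assoc)
    qed
    ultimately show "c (- N + (N - 1) - j) * q powi (2 * (- N + (N - 1) - j)) * bailey_kernel (N - 1) (2 * (- N + (N - 1) - j) + 1)
       = - (c j * q powi (2 * j) * bailey_kernel (N - 1) (2 * j + 1))"
      by simp
  qed
  finally have A: "A = 0" .
  have B: "B = 0"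
    unfolding B_def
  proof -
    have "(\<Sum>j=-N..N. c j * q powi (- 2 * j) * b j) = (\<Sum>j=-N..N. c j * b j)"
      unfolding sum_reflect_interval[of "\<lambda>j. c j * b j" "-N" N 0]
    proof (simp, rule sum.cong)
      fix j :: int
      have "3 * (-j)\<^sup>2 + (-j) = (3 * j\<^sup>2 + j) + (-2 * j)" by simp
      then have "c (-j) = c j * q powi (-2 * j)"
        using q_nonzero unfolding c_def by (metis (no_types, lifting) mult.assoc power_int_add power_int_minus_one_minus)
      then show "c j * q powi - (2 * j) * b j = c (- j) * b (- j)"
        by (simp add: b_def)
    qed simp
    then show "(\<Sum>j=-N..N. c j * (q powi (- 2 * j) - 1) * b j) = 0"
      by (simp add: algebra_simps sum_subtractf)
  qed
  have "C1_sum (n - 1) = (\<Sum>j=-N..N. c j * bailey_kernel (N - 1) (2 * j))"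
    unfolding C1_sum_def c_def using assms
    by (intro sum.mono_neutral_cong_left) (auto intro!: bailey_kernel_eq_0 simp: N_def of_nat_diff)
  then have "(1 - q ^ n) * (1 - q ^ (2 * n - 1)) * C1_sum n - C1_sum (n - 1) =
     (\<Sum>j=-N..N. (1 - q powi N) * (1 - q powi (2 * N - 1)) * (c j * b j) - c j * bailey_kernel (N - 1) (2 * j))"
    unfolding C1_sum_def npow sum_distrib_left sum_subtractf by (simp add: c_def b_def N_def)
  also have "\<dots> = (\<Sum>j=-N..N. q powi N * (c j * q powi (2 * j) * bailey_kernel (N - 1) (2 * j + 1)
      + (1 - q powi (2 * N - 1)) * (c j * (q powi (- 2 * j) - 1) * b j)))"
  proof (rule sum.cong)
    fix j
    define x where "x = q powi N"
    define y where "y = q powi (2 * j)"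
    define y' where "y' = q powi (- 2 * j)"
    define p where "p = q powi (-1)"
    have pw: "q powi (i + k) = q powi i * q powi k" for i k
      using q_nonzero by (simp add: power_int_add)
    have "y * y' = 1"
      unfolding y_def y'_def pw[symmetric] by simp
    have exps: "2 * N - 1 = N + N + -1" "N - 2 * j = N + - 2 * j" "N - 2 * j - 1 = N + - 2 * j + - 1"
      by linarith+
    have e: "q powi (2 * N - 1) = x * x * p" "q powi (N - 2 * j) = x * y'" "q powi (N + 2 * j) = x * y"
      "q powi (N - 2 * j - 1) = x * y' * p"
      unfolding exps(3) unfolding exps(1,2) x_def y_def y'_def p_def pw by (rule refl)+
    show "(1 - q powi N) * (1 - q powi (2 * N - 1)) * (c j * b j) - c j * bailey_kernel (N - 1) (2 * j) =
      q powi N * (c j * q powi (2 * j) * bailey_kernel (N - 1) (2 * j + 1)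
      + (1 - q powi (2 * N - 1)) * (c j * (q powi (- 2 * j) - 1) * b j))"
      unfolding bailey_kernel_pred_Suc[of N "2 * j"] bailey_kernel_pred[of N "2 * j"] b_def[symmetric] e
        x_def[symmetric] y_def[symmetric] y'_def[symmetric]
      using \<open>y * y' = 1\<close> by (rule C1_recurrence_certificate)
  qed simp
  also have "\<dots> = q powi N * (A + (1 - q powi (2 * N - 1)) * B)"
    unfolding A_def B_def by (rule sum_mult_add_mult)
  also have "\<dots> = 0"
    by (simp only: A B mult_zero_right add_0_left)
  finally show ?thesis
    by (simp only: right_minus_eq)
qed

lemma C1_sum_eq: "C1_sum n = inverse (odd_qpoch q n * qfact q n)"
proof (induction n)
  case 0
  show ?case by (simp add: C1_sum_def bailey_kernel_def inv_qfact_def qfact_def odd_qpoch_def)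
next
  case (Suc n)
  have nz: "1 - q ^ Suc n \<noteq> 0" "1 - q ^ (2 * Suc n - 1) \<noteq> 0"
    using q_not_root[of "Suc n"] q_not_root[of "2 * Suc n - 1"] by (metis eq_iff_diff_eq_0 zero_less_Suc, simp)
  have "C1_sum (Suc n) = C1_sum n / ((1 - q ^ Suc n) * (1 - q ^ (2 * Suc n - 1)))"
    using C1_sum_rec[of "Suc n"] nz
    by (metis (no_types, lifting) diff_Suc_1 mult_eq_0_iff nonzero_eq_divide_eq mult.commute zero_less_Suc)
  also have "\<dots> = inverse (odd_qpoch q (Suc n) * qfact q (Suc n))"
    unfolding Suc.IH by (simp add: qfact_def odd_qpoch_def field_simps)
  finally show ?case .
qed

lemma bailey_pair_unit:
  assumes "n > 0"
  shows "(\<Sum>r=1..n. bailey_alpha_unit q r * bailey_kernel (int n) (int r)) = - bailey_kernel (int n) 0"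
proof -
  have "(-1 :: 'a) powi int r * q powi (int r * (int r - 1) div 2) + (-1) powi (- int r) * q powi (- int r * (- int r - 1) div 2)
      = bailey_alpha_unit q r" if "r \<ge> 1" for r
  proof -
    have e: "int r * (int r - 1) div 2 = int (r * (r - 1) div 2)"
      using that by (simp add: zdiv_int of_nat_diff)
    have "- int r * (- int r - 1) div 2 = int r * (int r - 1) div 2 + int r"
      by (simp add: algebra_simps)
    then show ?thesis
      using q_nonzero unfolding e
      by (simp add: bailey_alpha_unit_def power_int_add power_int_minus_one_minus distrib_left)
  qed
  then have "(\<Sum>r=1..n. bailey_alpha_unit q r * bailey_kernel (int n) (int r)) =
     (\<Sum>r=1..n. (-1) powi int r * q powi (int r * (int r - 1) div 2) * bailey_kernel (int n) (int r)
       + (-1) powi (- int r) * q powi (- int r * (- int r - 1) div 2) * bailey_kernel (int n) (- int r))"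
    by (intro sum.cong refl) (simp only: atLeastAtMost_iff bailey_kernel_minus flip: distrib_right)
  then show ?thesis
    using unit_bailey_pair_int[OF assms] unfolding sum_symmetric_interval
    by (simp add: eq_neg_iff_add_eq_0 add.commute)
qed

lemma bailey_pair_C1:
  "(\<Sum>r=1..n. bailey_alpha_C1 q r * bailey_kernel (int n) (int r)) = C1_sum n - bailey_kernel (int n) 0"
proof -
  have coeff: "(-1 :: 'a) powi int j * q powi (3 * (int j)\<^sup>2 + int j) + (-1) powi (- int j) * q powi (3 * (- int j)\<^sup>2 + - int j)
      = bailey_alpha_C1 q (2 * j)" if "j \<ge> 1" for j
  proof -
    have "3 * (- int j)\<^sup>2 + - int j = int (j * (3 * j - 1))"
      using that by (simp add: of_nat_diff power2_eq_square algebra_simps)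
    moreover have "3 * (int j)\<^sup>2 + int j = int (j * (3 * j - 1)) + int (2 * j)"
      using that by (simp add: of_nat_diff power2_eq_square algebra_simps)
    ultimately show ?thesis
      using q_nonzero
      by (simp only: power_int_add power_int_of_nat power_int_minus_one_minus simp_thms)
        (simp add: bailey_alpha_C1_def distrib_left)
  qed
  have "(\<Sum>r=1..n. bailey_alpha_C1 q r * bailey_kernel (int n) (int r)) =
      (\<Sum>r=1..2*n. bailey_alpha_C1 q r * bailey_kernel (int n) (int r))"
    by (rule sum.mono_neutral_left) (auto simp: bailey_kernel_eq_0)
  also have "\<dots> = (\<Sum>j=1..n. bailey_alpha_C1 q (2 * j) * bailey_kernel (int n) (2 * int j))"
    unfolding sum_pairs unfolding One_nat_def sum.atLeast1_atMost_eq
    by (intro sum.cong refl) (simp add: bailey_alpha_C1_def)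
  also have "\<dots> = (\<Sum>j=1..n. (-1) powi int j * q powi (3 * (int j)\<^sup>2 + int j) * bailey_kernel (int n) (2 * int j)
       + (-1) powi (- int j) * q powi (3 * (- int j)\<^sup>2 + - int j) * bailey_kernel (int n) (2 * - int j))"
    by (intro sum.cong refl)
      (simp only: atLeastAtMost_iff coeff[symmetric] bailey_kernel_minus mult_minus_right distrib_right)
  finally show ?thesis
    unfolding C1_sum_def sum_symmetric_interval by simp
qed

text \<open>
  Subtracting the unit pair removes the term \<open>r = 0\<close> of the pair C(1) and leaves its \<open>\<beta>\<^sub>n\<close> unchanged.
\<close>
lemma bailey_pair:
  assumes "n > 0"
  shows "(\<Sum>r=1..n. bailey_alpha q r * (inverse (qfact q (n - r)) * inverse (qfact q (n + r)))) =
           inverse (odd_qpoch q n * qfact q n)"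
proof -
  have "bailey_kernel (int n) (int r) = inverse (qfact q (n - r)) * inverse (qfact q (n + r))" if "r \<in> {1..n}" for r
    using that by (simp add: bailey_kernel_def inv_qfact_def nat_diff_distrib nat_add_distrib)
  then have "(\<Sum>r=1..n. bailey_alpha q r * (inverse (qfact q (n - r)) * inverse (qfact q (n + r)))) =
      (\<Sum>r=1..n. bailey_alpha_C1 q r * bailey_kernel (int n) (int r)) - (\<Sum>r=1..n. bailey_alpha_unit q r * bailey_kernel (int n) (int r))"
    unfolding sum_subtractf[symmetric] by (intro sum.cong refl) (simp add: bailey_alpha_def algebra_simps)
  also have "\<dots> = inverse (odd_qpoch q n * qfact q n)"
    unfolding bailey_pair_unit[OF assms] bailey_pair_C1 C1_sum_eq by simp
  finally show ?thesis .
qed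

end

lemma to_fract_recip:
  fixes f :: "'a::idom fps"
  assumes "fps_nth f 0 = 1"
  shows "to_fract (fps_recip f) = inverse (to_fract f)"
proof -
  have "to_fract f * to_fract (fps_recip f) = 1"
    using fps_mult_recip[OF assms] by (metis to_fract_1 to_fract_mult)
  then show ?thesis
    by (metis inverse_unique)
qed

lemma to_fract_power: "to_fract (x ^ n) = to_fract x ^ n"
  by (induction n) simp_all

lemma to_fract_prod: "to_fract (prod f A) = prod (\<lambda>x. to_fract (f x)) A"
  by (induction A rule: infinite_finite_induct) simp_all

lemma qfact_nth_0 [simp]: "fps_nth (qfact fps_X n) 0 = 1"
  unfolding qfact_def by (induction n) simp_all

lemma odd_qpoch_nth_0 [simp]: "fps_nth (odd_qpoch fps_X n) 0 = 1"
  unfolding odd_qpoch_def by (induction n) simp_all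

text \<open>
  The identity between power series follows from the one in a field by passing to the field of
  fractions, where integer powers of \<open>q\<close> make sense.
\<close>
lemma bailey_pair_fps:
  assumes "n > 0"
  shows "(\<Sum>r=1..n. bailey_alpha fps_X r * (fps_recip (qfact fps_X (n - r)) * fps_recip (qfact fps_X (n + r)))) =
    (fps_recip (odd_qpoch fps_X n * qfact fps_X n) :: 'a::{idom,ring_char_0} fps)"
proof -
  define q where "q = to_fract (fps_X :: 'a fps)"
  have pow_ne: "(fps_X :: 'a fps) ^ n \<noteq> 1" if "n > 0" for n :: nat
  proof
    assume "(fps_X :: 'a fps) ^ n = 1"
    from arg_cong[OF this, of "\<lambda>f. fps_nth f 0"] show False
      using that by simp
  qed
  have q: "q \<noteq> 0" "\<And>n::nat. n > 0 \<Longrightarrow> q ^ n \<noteq> 1"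
    using pow_ne by (simp add: q_def, metis q_def to_fract_1 to_fract_eq_iff to_fract_power)
  have 1: "to_fract (qfact fps_X n :: 'a fps) = qfact q n" for n
    by (simp add: qfact_def q_def to_fract_prod to_fract_power)
  have 2: "to_fract (odd_qpoch fps_X n :: 'a fps) = odd_qpoch q n" for n
    by (simp add: odd_qpoch_def q_def to_fract_prod to_fract_power)
  have 3: "to_fract (bailey_alpha fps_X n :: 'a fps) = bailey_alpha q n" for n
    by (simp add: bailey_alpha_def bailey_alpha_C1_def bailey_alpha_unit_def q_def to_fract_power)
  have field_pair: "(\<Sum>r=1..n. bailey_alpha q r * (inverse (qfact q (n - r)) * inverse (qfact q (n + r)))) =
      inverse (odd_qpoch q n * qfact q n)"
  proof (rule bailey_pair)
    have "(2 :: 'a fps) \<noteq> 0"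
    proof
      assume "(2 :: 'a fps) = 0"
      from arg_cong[OF this, of "\<lambda>f. fps_nth f 0"] show False
        by (simp add: fps_numeral_nth_0)
    qed
    then have "to_fract (2 :: 'a fps) \<noteq> 0"
      by simp
    moreover have "to_fract (2 :: 'a fps) = 2"
      unfolding one_add_one[symmetric] to_fract_add to_fract_1 by (rule refl)
    ultimately show "(2 :: 'a fps fract) \<noteq> 0"
      by simp
    show "q \<noteq> 0" by (rule q(1))
    show "q ^ k \<noteq> 1" if "k > 0" for k :: nat
      using that by (rule q(2))
    show "n > 0" by (rule assms)
  qed
  show ?thesis
  proof (rule iffD1[OF to_fract_eq_iff])
    show "to_fract (\<Sum>r=1..n. bailey_alpha fps_X r * (fps_recip (qfact fps_X (n - r)) * fps_recip (qfact fps_X (n + r)))) =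
      to_fract (fps_recip (odd_qpoch fps_X n * qfact fps_X n) :: 'a fps)"
      using field_pair
      by (simp only: to_fract_sum to_fract_mult 3 to_fract_recip qfact_nth_0 odd_qpoch_nth_0
          fps_mult_nth_0 mult_1 1 2)
  qed
qed

section \<open>Congruences of power series modulo powers of the variable\<close>

definition fps_cong :: "nat \<Rightarrow> 'a::comm_ring_1 fps \<Rightarrow> 'a fps \<Rightarrow> bool" where
  "fps_cong N f g \<longleftrightarrow> fps_X ^ N dvd f - g"

lemma fps_X_power_dvd_iff: "fps_X ^ N dvd (f :: 'a::comm_ring_1 fps) \<longleftrightarrow> (\<forall>i<N. fps_nth f i = 0)"
proof
  assume "\<forall>i<N. fps_nth f i = 0"
  then have "f = fps_X ^ N * fps_shift N f"
    by (intro fps_ext) (simp add: fps_X_power_mult_nth)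
  then show "fps_X ^ N dvd f" by (metis dvdI)
qed (auto simp: dvd_def fps_X_power_mult_nth)

lemma fps_cong_iff: "fps_cong N f g \<longleftrightarrow> (\<forall>i<N. fps_nth f i = fps_nth g i)"
  by (auto simp: fps_cong_def fps_X_power_dvd_iff)

lemma fps_cong_refl [simp]: "fps_cong N f f"
  by (simp add: fps_cong_def)

lemma fps_cong_sym: "fps_cong N f g \<Longrightarrow> fps_cong N g f"
  by (simp add: fps_cong_iff)

lemma fps_cong_trans [trans]: "fps_cong N f g \<Longrightarrow> fps_cong N g h \<Longrightarrow> fps_cong N f h"
  by (simp add: fps_cong_iff)

lemma fps_cong_mono: "fps_cong N f g \<Longrightarrow> M \<le> N \<Longrightarrow> fps_cong M f g"
  by (simp add: fps_cong_iff)

lemma fps_cong_mult: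
  assumes "fps_cong N f f'" "fps_cong N g g'"
  shows "fps_cong N (f * g) (f' * g')"
proof -
  have "f * g - f' * g' = (f - f') * g + f' * (g - g')"
    by (simp add: algebra_simps)
  then show ?thesis
    using assms unfolding fps_cong_def by (metis dvd_add dvd_mult dvd_mult2)
qed

lemma fps_cong_sum: "(\<And>x. x \<in> A \<Longrightarrow> fps_cong N (f x) (g x)) \<Longrightarrow> fps_cong N (sum f A) (sum g A)"
  by (simp add: fps_cong_iff fps_sum_nth)

lemma fps_cong_X_mult:
  "fps_cong N f g \<Longrightarrow> fps_cong (k + N) (fps_X ^ k * f) (fps_X ^ k * g)"
  by (auto simp: fps_cong_iff fps_X_power_mult_nth)

lemma fps_eqI_cong: "(\<And>N. fps_cong N f g) \<Longrightarrow> f = g"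
  by (rule fps_ext) (auto simp: fps_cong_iff)

lemma fps_cong_one_prod:
  assumes "\<And>x. x \<in> A \<Longrightarrow> fps_cong N (f x) 1"
  shows "fps_cong N (prod f A) 1"
  using assms
proof (induction A rule: infinite_finite_induct)
  case (insert x A)
  then show ?case using fps_cong_mult[of N "f x" 1 "prod f A" 1] by simp
qed simp_all

lemma fps_cong_recip_one:
  assumes "fps_cong N f 1" "N > 0"
  shows "fps_cong N (fps_recip f) 1"
proof -
  have f0: "fps_nth f 0 = 1" using assms by (simp add: fps_cong_iff)
  have "fps_cong N (f * fps_recip f) (1 * fps_recip f)"
    by (intro fps_cong_mult assms) simp
  then show ?thesis
    by (simp add: fps_mult_recip[OF f0] fps_cong_sym)
qed

lemma qpoch_inf_cong:
  fixes a :: "'a::idom fps"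
  assumes a: "fps_nth a 0 = 0" and d: "d > 0" and "N \<le> d * n"
  shows "fps_cong N (qpoch_inf a (fps_X ^ d)) (\<Prod>k<n. 1 - a * (fps_X ^ d) ^ k)"
proof -
  define P where "P n = (\<Prod>k<n. 1 - a * (fps_X ^ d) ^ k)" for n
  have P: "P \<longlonglongrightarrow> qpoch_inf a (fps_X ^ d)"
    unfolding P_def by (rule has_prod_imp_tendsto'[OF qpoch_inf_has_prod(1)[OF a d]])
  have stable: "fps_cong N (P n') (P n)" if "n' \<ge> n" for n'
    using that
  proof (induction n' rule: dec_induct)
    case (step k)
    have "fps_cong N (1 - a * (fps_X ^ d) ^ k) 1"
    proof -
      have "N \<le> d * k"
        using step.hyps assms(3) by (meson le_trans mult_le_mono2)
      then show ?thesis
        by (simp add: fps_cong_iff fps_X_power_mult_right_nth flip: power_mult)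
    qed
    from fps_cong_mult[OF step.IH this] show ?case
      by (simp add: P_def)
  qed simp
  show ?thesis
    unfolding fps_cong_iff
  proof (intro allI impI)
    fix i assume i: "i < N"
    have "\<forall>\<^sub>F k in sequentially. fps_nth (P k) i = fps_nth (qpoch_inf a (fps_X ^ d)) i"
      using P unfolding tendsto_fps_iff by blast
    then obtain k where "k \<ge> n" "fps_nth (P k) i = fps_nth (qpoch_inf a (fps_X ^ d)) i"
      unfolding eventually_sequentially by (metis nle_le)
    then show "fps_nth (qpoch_inf a (fps_X ^ d)) i = fps_nth (\<Prod>k<n. 1 - a * (fps_X ^ d) ^ k) i"
      using stable[of k] i by (simp add: fps_cong_iff P_def)
  qed
qed

lemma qpoch_inf_X_cong:
  fixes a :: "'a::idom fps"
  assumes a: "fps_nth a 0 = 0"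
  shows "fps_cong N (qpoch_inf a fps_X) (\<Prod>k<N. 1 - a * fps_X ^ k)"
  using qpoch_inf_cong[OF a, of 1 N N] by simp

lemma qpoch_inf_Suc:
  fixes a :: "'a::idom fps"
  assumes a: "fps_nth a 0 = 0"
  shows "qpoch_inf a fps_X = (1 - a) * qpoch_inf (a * fps_X) fps_X"
proof (rule fps_eqI_cong)
  fix N
  have "fps_cong N (qpoch_inf a fps_X) (\<Prod>k<Suc N. 1 - a * fps_X ^ k)"
    using qpoch_inf_X_cong[OF a, of "Suc N"] by (rule fps_cong_mono) simp
  also have "(\<Prod>k<Suc N. 1 - a * fps_X ^ k) = (1 - a) * (\<Prod>k<N. 1 - (a * fps_X) * fps_X ^ k)"
    unfolding prod.lessThan_Suc_shift by (simp add: mult.assoc)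
  also have "fps_cong N \<dots> ((1 - a) * qpoch_inf (a * fps_X) fps_X)"
    using a by (intro fps_cong_mult fps_cong_refl fps_cong_sym[OF qpoch_inf_X_cong]) simp
  finally show "fps_cong N (qpoch_inf a fps_X) ((1 - a) * qpoch_inf (a * fps_X) fps_X)" .
qed

lemma qpoch_inf_cong_one:
  fixes a :: "'a::idom fps"
  assumes "fps_cong N a 0" "N > 0"
  shows "fps_cong N (qpoch_inf a fps_X) 1"
proof -
  have "fps_nth a 0 = 0" using assms by (simp add: fps_cong_iff)
  from qpoch_inf_X_cong[OF this] have "fps_cong N (qpoch_inf a fps_X) (\<Prod>k<N. 1 - a * fps_X ^ k)" .
  also have "fps_cong N \<dots> 1"
    using assms by (intro fps_cong_one_prod) (auto simp: fps_cong_iff fps_X_power_mult_right_nth)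
  finally show ?thesis .
qed

lemma fps_recip_mult:
  fixes f g :: "'a::idom fps"
  assumes "fps_nth f 0 = 1" "fps_nth g 0 = 1"
  shows "fps_recip (f * g) = fps_recip f * fps_recip g"
proof -
  have "(f * g) * (fps_recip f * fps_recip g) = (f * g) * fps_recip (f * g)"
    using fps_mult_recip[OF assms(1)] fps_mult_recip[OF assms(2)] fps_mult_recip[of "f * g"] assms
    by (simp add: mult_ac)
  moreover have "f * g \<noteq> 0"
    using assms by (metis fps_mult_nth_0 fps_zero_nth mult_1 zero_neq_one)
  ultimately show ?thesis by simp
qed

section \<open>The telescoping sum over n\<close>

definition recip_z_tail :: "nat \<Rightarrow> int_laurent fps" where
  "recip_z_tail n = fps_recip (qpoch_inf (zz * qq ^ n) qq) * fps_recip (qpoch_inf (zz_inv * qq ^ n) qq)"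

definition recip_z_factor :: "nat \<Rightarrow> int_laurent fps" where
  "recip_z_factor r = fps_recip (1 - zz * qq ^ r) * fps_recip (1 - zz_inv * qq ^ r)"

lemma recip_z_factor_inverse:
  assumes "r > 0"
  shows "(1 - zz * qq ^ r) * (1 - zz_inv * qq ^ r) * recip_z_factor r = 1"
  using fps_mult_recip[of "1 - zz * qq ^ r"] fps_mult_recip[of "1 - zz_inv * qq ^ r"] assms
  by (simp add: recip_z_factor_def mult_ac)

lemma recip_z_tail_eq:
  assumes "n > 0"
  shows "recip_z_tail n = recip_z_factor n * recip_z_tail (Suc n)"
proof -
  have "qpoch_inf (x * qq ^ n) qq = (1 - x * qq ^ n) * qpoch_inf (x * qq ^ Suc n) qq" for x
    using qpoch_inf_Suc[of "x * qq ^ n"] assms by (simp add: mult_ac)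
  then show ?thesis
    using assms C1_denominators_nth_0(1,2)[of "Suc n"]
    by (simp add: recip_z_tail_def recip_z_factor_def fps_recip_mult del: power_Suc)
qed

lemma recip_z_tail_cong_one:
  assumes "n > 0"
  shows "fps_cong n (recip_z_tail n) 1"
proof -
  have "fps_cong n (fps_recip (qpoch_inf (x * qq ^ n) qq)) 1" for x
    using assms by (intro fps_cong_recip_one qpoch_inf_cong_one) (auto simp: fps_cong_iff fps_X_power_mult_right_nth)
  from fps_cong_mult[OF this this] show ?thesis
    unfolding recip_z_tail_def by simp
qed

definition recip_qfact :: "nat \<Rightarrow> 'a::comm_ring_1 fps" where
  "recip_qfact n = fps_recip (qfact fps_X n)"

lemma qfact_recip_qfact: "qfact fps_X n * recip_qfact n = (1 :: 'a::idom fps)"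
  by (simp add: recip_qfact_def fps_mult_recip)

lemma recip_qfact_Suc: "recip_qfact n = (1 - fps_X ^ Suc n) * (recip_qfact (Suc n) :: 'a::idom fps)"
proof -
  have "qfact fps_X (Suc n) = qfact fps_X n * (1 - fps_X ^ Suc n :: 'a fps)"
    by (simp add: qfact_def)
  then have "recip_qfact (Suc n) = recip_qfact n * fps_recip (1 - fps_X ^ Suc n :: 'a fps)"
    unfolding recip_qfact_def by (simp add: fps_recip_mult)
  then show ?thesis
    using fps_mult_recip[of "1 - fps_X ^ Suc n :: 'a fps"] 
    by (simp add: mult_ac del: power_Suc)
qed

text \<open>
  The identity behind the telescoping, with \<open>b = q\<^sup>r\<close> and \<open>c = q\<^sup>M\<^sup>+\<^sup>1\<^sup>-\<^sup>r\<close>.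
\<close>
lemma telescoping_certificate:
  fixes z z' b c :: "'a::comm_ring_1"
  assumes "z * z' = 1"
  shows "(1 - z * (c * b)) * (1 - z' * (c * b)) - (1 - c) * (1 - c * b * b) = c * ((1 - z * b) * (1 - z' * b))"
proof -
  have "z * (z' * t) = t" for t
    using assms by (metis mult.assoc mult_1_left)
  then show ?thesis
    using assms by (simp add: algebra_simps)
qed

text \<open>
  This is the case of the \<open>q\<close>-Gauss sum in which the partial sums have a closed form, with the factors
  \<open>(zq\<^sup>n)\<^sub>\<infinity>\<close> and \<open>(q\<^sup>n/z)\<^sub>\<infinity>\<close> in the denominator. As \<open>M\<close> grows, the right-hand side tends to
  \<open>q\<^sup>r/((1 - zq\<^sup>r)(1 - q\<^sup>r/z))\<close> divided by the square of \<open>(q)\<^sub>\<infinity>\<close>.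
\<close>
lemma conjugate_bailey_sum:
  assumes "r > 0" "r \<le> M"
  shows "(\<Sum>n=r..M. qq ^ n * recip_z_tail n * (recip_qfact (n - r) * recip_qfact (n + r))) =
           qq ^ r * recip_z_factor r * (recip_qfact (M - r) * recip_qfact (M + r)) * recip_z_tail (Suc M)"
  using assms(2)
proof (induction M rule: dec_induct)
  case base
  show ?case
    by (simp add: recip_z_tail_eq[OF assms(1)] mult_ac)
next
  case (step M)
  define L where "L = Suc M"
  have z: "zz * zz_inv = 1" by (rule zz_mult_zz_inv)
  define k where "k = L - r"
  have L: "L = k + r" using step.hyps by (simp add: L_def k_def)
  define A where "A = (1 - zz * qq ^ r) * (1 - zz_inv * qq ^ r)"
  define B where "B = (1 - zz * qq ^ L) * (1 - zz_inv * qq ^ L)"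
  define C where "C = recip_qfact k * recip_qfact (L + r) * (recip_z_factor r * recip_z_factor L * recip_z_tail (Suc L))"
  have A: "A * recip_z_factor r = 1" and B: "B * recip_z_factor L = 1"
    unfolding A_def B_def using assms(1) by (intro recip_z_factor_inverse; simp add: L_def)+
  have prev: "recip_qfact (M - r) * recip_qfact (M + r) =
     (1 - qq ^ k) * (1 - qq ^ (L + r)) * (recip_qfact k * recip_qfact (L + r))"
  proof -
    have "Suc (M - r) = k" "Suc (M + r) = L + r"
      using step.hyps by (simp_all add: L_def k_def)
    then show ?thesis
      unfolding recip_qfact_Suc[of "M - r"] recip_qfact_Suc[of "M + r"] by (simp only: mult_ac)
  qed
  have key: "B - (1 - qq ^ k) * (1 - qq ^ (L + r)) = qq ^ k * A"
    unfolding A_def B_def L power_add using z by (rule telescoping_certificate)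
  have th: "recip_z_tail L = recip_z_factor L * recip_z_tail (Suc L)"
    by (rule recip_z_tail_eq) (simp add: L_def)
  have "qq ^ r * recip_z_factor r * (recip_qfact (M - r) * recip_qfact (M + r)) * recip_z_tail L
     = qq ^ r * C * ((1 - qq ^ k) * (1 - qq ^ (L + r)))"
    unfolding prev th C_def by (simp only: mult_ac)
  moreover have "qq ^ L * recip_z_tail L * (recip_qfact k * recip_qfact (L + r)) = qq ^ r * C * (qq ^ k * A)"
  proof -
    have "qq ^ r * C * (qq ^ k * A) = (A * recip_z_factor r) * (qq ^ L * recip_z_tail L * (recip_qfact k * recip_qfact (L + r)))"
      unfolding C_def th by (simp only: L power_add mult_ac)
    then show ?thesis by (simp only: A mult_1_left)
  qed
  ultimately have "qq ^ r * recip_z_factor r * (recip_qfact (M - r) * recip_qfact (M + r)) * recip_z_tail L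
     + qq ^ L * recip_z_tail L * (recip_qfact k * recip_qfact (L + r))
     = qq ^ r * C * ((1 - qq ^ k) * (1 - qq ^ (L + r)) + qq ^ k * A)"
    by (simp only: distrib_left)
  also have "\<dots> = qq ^ r * C * B"
    unfolding key[symmetric] by (simp only: add_diff_eq add_diff_cancel_left')
  also have "\<dots> = qq ^ r * recip_z_factor r * (recip_qfact k * recip_qfact (L + r)) * recip_z_tail (Suc L)"
  proof -
    have "qq ^ r * C * B = (B * recip_z_factor L) * (qq ^ r * recip_z_factor r * (recip_qfact k * recip_qfact (L + r)) * recip_z_tail (Suc L))"
      unfolding C_def by (simp only: mult_ac)
    then show ?thesis by (simp only: B mult_1_left)
  qed
  finally show ?case
    using step.IH step.hyps by (simp only: L_def k_def sum.cl_ivl_Suc) simp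
qed

lemma sum_triangle_swap:
  fixes f :: "nat \<Rightarrow> nat \<Rightarrow> 'a::comm_monoid_add"
  shows "(\<Sum>n=1..M. \<Sum>r=1..n. f n r) = (\<Sum>r=1..M. \<Sum>n=r..M. f n r)"
proof -
  have "{r. r \<in> {1..M} \<and> r \<le> n} = {1..n}" if "n \<in> {1..M}" for n
    using that by auto
  moreover have "{n. n \<in> {1..M} \<and> r \<le> n} = {r..M}" if "r \<in> {1..M}" for r
    using that by auto
  ultimately show ?thesis
    using sum.swap_restrict[of "{1..M}" "{1..M}" f "\<lambda>n r. r \<le> n"] by simp
qed

lemma C1_partial_sum:
  "(\<Sum>n=1..M. C1_term n) =
     (\<Sum>r=1..M. bailey_alpha qq r * (qq ^ r * recip_z_factor r * (recip_qfact (M - r) * recip_qfact (M + r)) * recip_z_tail (Suc M)))"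
proof -
  have denom: "qpoch qq (qq ^ 2) n * qpoch qq qq n = odd_qpoch qq n * qfact qq n" for n
  proof -
    have "qq * (qq ^ 2) ^ (k - 1) = qq ^ (2 * k - 1)" "qq * qq ^ (k - 1) = qq ^ k" if "k \<in> {1..n}" for k
    proof -
      have "k \<noteq> 0"
        using that by simp
      then obtain j where "k = Suc j"
        by (metis not0_implies_Suc)
      then have "2 * k - 1 = Suc (2 * j)" "k - 1 = j" "k = Suc j"
        by simp_all
      then show "qq * (qq ^ 2) ^ (k - 1) = qq ^ (2 * k - 1)" "qq * qq ^ (k - 1) = qq ^ k"
        by (simp_all only: power_Suc power_mult)
    qed
    then show ?thesis
      unfolding qpoch_def odd_qpoch_def qfact_def by (intro arg_cong2[where f = times] prod.cong refl) (simp_all only:)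
  qed
  have term_eq: "C1_term n = (\<Sum>r=1..n. bailey_alpha qq r * (qq ^ n * recip_z_tail n * (recip_qfact (n - r) * recip_qfact (n + r))))"
    if "n \<ge> 1" for n
  proof -
    have "C1_term n = (qq ^ n * recip_z_tail n) * fps_recip (odd_qpoch qq n * qfact qq n)"
      by (simp only: C1_term_def denom recip_z_tail_def)
    also have "fps_recip (odd_qpoch qq n * qfact qq n) =
        (\<Sum>r=1..n. bailey_alpha qq r * (recip_qfact (n - r) * recip_qfact (n + r)))"
      using that unfolding recip_qfact_def by (intro bailey_pair_fps[symmetric]) simp
    also have "(qq ^ n * recip_z_tail n) * \<dots> =
        (\<Sum>r=1..n. bailey_alpha qq r * (qq ^ n * recip_z_tail n * (recip_qfact (n - r) * recip_qfact (n + r))))"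
      unfolding sum_distrib_left by (intro sum.cong refl) (simp only: mult_ac)
    finally show ?thesis .
  qed
  have "(\<Sum>n=1..M. C1_term n) =
      (\<Sum>n=1..M. \<Sum>r=1..n. bailey_alpha qq r * (qq ^ n * recip_z_tail n * (recip_qfact (n - r) * recip_qfact (n + r))))"
    by (intro sum.cong refl term_eq) simp
  also have "\<dots> = (\<Sum>r=1..M. \<Sum>n=r..M. bailey_alpha qq r * (qq ^ n * recip_z_tail n * (recip_qfact (n - r) * recip_qfact (n + r))))"
    by (rule sum_triangle_swap)
  also have "\<dots> = (\<Sum>r=1..M. bailey_alpha qq r * (qq ^ r * recip_z_factor r * (recip_qfact (M - r) * recip_qfact (M + r)) * recip_z_tail (Suc M)))"
  proof (intro sum.cong refl)
    fix r assume "r \<in> {1..M}"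
    then show "(\<Sum>n=r..M. bailey_alpha qq r * (qq ^ n * recip_z_tail n * (recip_qfact (n - r) * recip_qfact (n + r)))) =
        bailey_alpha qq r * (qq ^ r * recip_z_factor r * (recip_qfact (M - r) * recip_qfact (M + r)) * recip_z_tail (Suc M))"
      unfolding sum_distrib_left[symmetric] by (subst conjugate_bailey_sum) simp_all
  qed
  finally show ?thesis .
qed

section \<open>The generating function modulo a power of q\<close>

lemma qfact_mult_recip_qfact_cong:
  assumes "n \<le> T"
  shows "fps_cong (Suc n) (qfact fps_X T * recip_qfact n) (1 :: 'a::idom fps)"
proof -
  have "{1..T} = {1..n} \<union> {Suc n..T}"
    using assms by auto
  then have "qfact fps_X T = qfact fps_X n * (\<Prod>k=Suc n..T. 1 - fps_X ^ k :: 'a fps)"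
    unfolding qfact_def by (simp add: prod.union_disjoint)
  then have "qfact fps_X T * recip_qfact n = (\<Prod>k=Suc n..T. 1 - fps_X ^ k :: 'a fps)"
    using qfact_recip_qfact[of n, where 'a = 'a] by (simp add: mult_ac)
  moreover have "fps_cong (Suc n) (\<Prod>k=Suc n..T. 1 - fps_X ^ k :: 'a fps) 1"
    by (rule fps_cong_one_prod) (auto simp: fps_cong_iff)
  ultimately show ?thesis by simp
qed

lemma qfact_even_mult_odd_qpoch: "qfact (q ^ 2) n * odd_qpoch q n = qfact q (2 * n)"
proof (induction n)
  case (Suc n)
  have "qfact (q ^ 2) (Suc n) * odd_qpoch q (Suc n) =
      (qfact (q ^ 2) n * odd_qpoch q n) * ((1 - (q ^ 2) ^ Suc n) * (1 - q ^ (2 * Suc n - 1)))"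
    by (simp add: qfact_def odd_qpoch_def mult_ac)
  also have "(q ^ 2) ^ Suc n = q ^ Suc (Suc (2 * n))"
    by (simp only: power_mult[symmetric]) simp
  also have "qfact (q ^ 2) n * odd_qpoch q n * ((1 - q ^ Suc (Suc (2 * n))) * (1 - q ^ (2 * Suc n - 1))) = qfact q (2 * Suc n)"
    unfolding Suc.IH by (simp add: qfact_def mult_ac)
  finally show ?case .
qed (simp add: qfact_def odd_qpoch_def)

lemma C1_suminf_cong: "fps_cong (Suc M) (suminf (\<lambda>n. C1_term (Suc n))) (\<Sum>n=1..M. C1_term n)"
  unfolding fps_cong_iff
proof (intro allI impI)
  fix i assume i: "i < Suc M"
  have "(\<lambda>n. \<Sum>k<n. C1_term (Suc k)) \<longlonglongrightarrow> suminf (\<lambda>n. C1_term (Suc n))"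
    by (rule summable_LIMSEQ[OF summable_C1_term])
  then have "\<forall>\<^sub>F n in sequentially. fps_nth (\<Sum>k<n. C1_term (Suc k)) i = fps_nth (suminf (\<lambda>n. C1_term (Suc n))) i"
    unfolding tendsto_fps_iff by blast
  then obtain n where n: "n \<ge> M" "fps_nth (\<Sum>k<n. C1_term (Suc k)) i = fps_nth (suminf (\<lambda>n. C1_term (Suc n))) i"
    unfolding eventually_sequentially by (metis nle_le)
  have "fps_nth (C1_term (Suc k)) i = 0" if "k \<ge> M" for k
    using that i unfolding C1_term_def mult.assoc fps_X_power_mult_nth by simp
  then have "(\<Sum>k<n. fps_nth (C1_term (Suc k)) i) = (\<Sum>k<M. fps_nth (C1_term (Suc k)) i)"
    using n(1) by (intro sum.mono_neutral_right) auto
  also have "\<dots> = (\<Sum>k=1..M. fps_nth (C1_term k) i)"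
    by (rule sum.reindex_bij_witness[of _ "\<lambda>k. k - 1" Suc]) auto
  finally show "fps_nth (suminf (\<lambda>n. C1_term (Suc n))) i = fps_nth (\<Sum>n=1..M. C1_term n) i"
    using n(2) by (simp add: fps_sum_nth)
qed

text \<open>
  In the \<open>r\<close>-th term the factor \<open>q\<^sup>r\<close> makes up for the smaller precision of \<open>1/(q)\<^sub>M\<^sub>-\<^sub>r\<close>, which agrees
  with \<open>1/(q)\<^sub>\<infinity>\<close> only modulo \<open>q\<^sup>M\<^sup>-\<^sup>r\<^sup>+\<^sup>1\<close>.
\<close>
lemma C1_gf_cong:
  "fps_cong (Suc M) (qfact (qq ^ 2) (Suc M) * C1_gf) (\<Sum>r=1..M. bailey_alpha qq r * (qq ^ r * recip_z_factor r))"
proof -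
  \<comment> \<open>Truncating the products at \<open>M + 1\<close> factors is exact modulo \<open>q\<^sup>M\<^sup>+\<^sup>1\<close>.\<close>
  define T where "T = Suc M"
  have inf: "fps_cong (Suc M) (qpoch_inf qq (qq ^ 2)) (odd_qpoch qq T)" "fps_cong (Suc M) (qpoch_inf qq qq) (qfact qq T)"
  proof -
    have "(\<Prod>k<T. 1 - qq * (qq ^ 2) ^ k) = odd_qpoch qq T" "(\<Prod>k<T. 1 - qq * (qq ^ 1) ^ k) = qfact qq T"
      unfolding odd_qpoch_def qfact_def
      by (rule prod.reindex_bij_witness[of _ "\<lambda>k. k - 1" Suc]; auto simp flip: power_mult)+
    then show "fps_cong (Suc M) (qpoch_inf qq (qq ^ 2)) (odd_qpoch qq T)" "fps_cong (Suc M) (qpoch_inf qq qq) (qfact qq T)"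
      using qpoch_inf_cong[of qq 2 "Suc M" T] qpoch_inf_cong[of qq 1 "Suc M" T]
      by (simp_all add: T_def)
  qed
  have "fps_cong (Suc M) (qfact (qq ^ 2) T * C1_gf) (qfact (qq ^ 2) T * (odd_qpoch qq T * qfact qq T * (\<Sum>n=1..M. C1_term n)))"
    unfolding C1_gf_def by (intro fps_cong_mult fps_cong_refl inf C1_suminf_cong)
  also have "qfact (qq ^ 2) T * (odd_qpoch qq T * qfact qq T * (\<Sum>n=1..M. C1_term n)) =
      (\<Sum>r=1..M. bailey_alpha qq r * (qq ^ r * (qfact qq T * recip_qfact (M - r)) * recip_z_factor r *
         (qfact qq (2 * T) * recip_qfact (M + r)) * recip_z_tail (Suc M)))"
    unfolding C1_partial_sum qfact_even_mult_odd_qpoch[symmetric] sum_distrib_left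
    by (intro sum.cong refl) (simp only: mult_ac)
  also have "fps_cong (Suc M) \<dots> (\<Sum>r=1..M. bailey_alpha qq r * (qq ^ r * 1 * recip_z_factor r * 1 * 1))"
  proof (intro fps_cong_sum)
    fix r assume r: "r \<in> {1..M}"
    have "fps_cong (r + Suc (M - r)) (qq ^ r * (qfact qq T * recip_qfact (M - r))) (qq ^ r * 1)"
      by (intro fps_cong_X_mult qfact_mult_recip_qfact_cong) (simp add: T_def)
    then have 1: "fps_cong (Suc M) (qq ^ r * (qfact qq T * recip_qfact (M - r))) (qq ^ r * 1)"
      using r by simp
    have "fps_cong (Suc (M + r)) (qfact qq (2 * T) * recip_qfact (M + r)) 1"
      using r by (intro qfact_mult_recip_qfact_cong) (simp add: T_def)
    then have 2: "fps_cong (Suc M) (qfact qq (2 * T) * recip_qfact (M + r)) 1"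
      by (rule fps_cong_mono) simp
    have 3: "fps_cong (Suc M) (recip_z_tail (Suc M)) 1"
      by (rule recip_z_tail_cong_one) simp
    show "fps_cong (Suc M)
        (bailey_alpha qq r * (qq ^ r * (qfact qq T * recip_qfact (M - r)) * recip_z_factor r *
           (qfact qq (2 * T) * recip_qfact (M + r)) * recip_z_tail (Suc M)))
        (bailey_alpha qq r * (qq ^ r * 1 * recip_z_factor r * 1 * 1))"
      by (rule fps_cong_mult[OF fps_cong_refl fps_cong_mult[OF fps_cong_mult[OF fps_cong_mult[OF 1 fps_cong_refl] 2] 3]])
  qed
  finally show ?thesis
    by (simp add: T_def)
qed

section \<open>The coefficient of a fixed power of z\<close>

definition zcoeff :: "int \<Rightarrow> int_laurent fps \<Rightarrow> int fps" where
  "zcoeff m f = Abs_fps (\<lambda>n. Poly_Mapping.lookup (fps_nth f n) m)"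

lemma zcoeff_nth: "fps_nth (zcoeff m f) n = Poly_Mapping.lookup (fps_nth f n) m"
  by (simp add: zcoeff_def)

lemma zcoeff_add: "zcoeff m (f + g) = zcoeff m f + zcoeff m g"
  by (rule fps_ext) (simp add: zcoeff_nth lookup_add)

lemma zcoeff_diff: "zcoeff m (f - g) = zcoeff m f - zcoeff m g"
  by (rule fps_ext) (simp add: zcoeff_nth lookup_minus)

lemma zcoeff_uminus: "zcoeff m (- f) = - zcoeff m f"
  by (rule fps_ext) (simp add: zcoeff_nth)

lemma zcoeff_sum: "zcoeff m (sum f A) = (\<Sum>x\<in>A. zcoeff m (f x))"
  by (rule fps_ext) (simp add: zcoeff_nth fps_sum_nth lookup_sum)

lemma zcoeff_X_power_mult: "zcoeff m (qq ^ k * f) = fps_X ^ k * zcoeff m f"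
  by (rule fps_ext) (simp add: zcoeff_nth fps_X_power_mult_nth)

lemma zcoeff_minus_one_power_mult: "zcoeff m ((-1) ^ k * f) = (-1) ^ k * zcoeff m f"
  by (cases "even k") (simp_all add: zcoeff_uminus)

lemma zcoeff_qfact_mult: "zcoeff m (qfact (qq ^ 2) n * f) = qfact (fps_X ^ 2) n * zcoeff m f"
proof (induction n)
  case (Suc n)
  have *: "qfact x (Suc n) * y = qfact x n * y - x ^ Suc n * (qfact x n * y)" for x y :: "'a::comm_ring_1"
    by (simp add: qfact_def algebra_simps)
  show ?case
    unfolding * zcoeff_diff power_mult[symmetric] zcoeff_X_power_mult Suc.IH by (rule refl)
qed (simp add: qfact_def)

lemma zcoeff_bailey_alpha_mult: "zcoeff m (bailey_alpha qq r * f) = bailey_alpha fps_X r * zcoeff m f"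
proof -
  have *: "zcoeff m ((-1) ^ k * qq ^ a * (1 + qq ^ b) * f) = (-1) ^ k * fps_X ^ a * (1 + fps_X ^ b) * zcoeff m f" for k a b
    unfolding mult.assoc zcoeff_minus_one_power_mult zcoeff_X_power_mult distrib_right zcoeff_add mult_1_left by (rule refl)
  have "zcoeff m (bailey_alpha_C1 qq r * f) = bailey_alpha_C1 fps_X r * zcoeff m f"
  proof (cases "even r")
    case True
    then show ?thesis by (simp only: bailey_alpha_C1_def if_True *)
  next
    case False
    then show ?thesis by (simp add: bailey_alpha_C1_def fps_eq_iff zcoeff_nth)
  qed
  then show ?thesis
    unfolding bailey_alpha_def left_diff_distrib zcoeff_diff by (simp only: bailey_alpha_unit_def *)
qed

lemma single_power: "Poly_Mapping.single s (1 :: int) ^ k = Poly_Mapping.single (int k * s) 1"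
  by (induction k) (simp_all add: Poly_Mapping.mult_single algebra_simps)

lemma recip_eqI:
  fixes f g :: "'a::comm_ring_1 fps"
  assumes "f * g = 1" "fps_nth f 0 = 1"
  shows "fps_recip f = g"
  using fps_mult_recip[OF assms(2)] assms(1) by (metis mult.commute mult.left_commute mult_1_right)

lemma recip_one_minus_const_X_power:
  fixes c :: "'a::comm_ring_1"
  assumes "r > 0"
  shows "fps_recip (1 - fps_const c * fps_X ^ r) = Abs_fps (\<lambda>n. if r dvd n then c ^ (n div r) else 0)"
proof -
  define G where "G = Abs_fps (\<lambda>n. if r dvd n then c ^ (n div r) else 0)"
  have "(1 - fps_const c * fps_X ^ r) * G = 1"
  proof (rule fps_ext)
    fix n
    have nth: "fps_nth ((1 - fps_const c * fps_X ^ r) * G) n = fps_nth G n - c * (if n < r then 0 else fps_nth G (n - r))"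
      by (simp add: left_diff_distrib mult.assoc fps_X_power_mult_nth)
    show "fps_nth ((1 - fps_const c * fps_X ^ r) * G) n = fps_nth 1 n"
    proof (cases "n < r")
      case True
      then show ?thesis
        unfolding nth using assms by (auto simp: G_def dest: dvd_imp_le)
    next
      case False
      then obtain k where "n = r + k"
        by (metis le_add_diff_inverse not_less)
      then show ?thesis
        unfolding nth using assms by (simp add: G_def)
    qed
  qed
  then show ?thesis
    unfolding G_def using assms by (intro recip_eqI) auto
qed

lemma zcoeff_geometric:
  assumes "r > 0" "s = 1 \<or> s = -1"
  shows "zcoeff m (fps_recip (1 - fps_const (Poly_Mapping.single s 1) * qq ^ r)) =
           (if s * m \<ge> 0 then fps_X ^ (r * nat (s * m)) else 0)"
proof (rule fps_ext)
  fix n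
  have "fps_nth (zcoeff m (fps_recip (1 - fps_const (Poly_Mapping.single s 1) * qq ^ r))) n =
      (if r dvd n \<and> int (n div r) * s = m then 1 else 0)"
    unfolding recip_one_minus_const_X_power[OF assms(1)] zcoeff_nth
    by (simp add: single_power lookup_single when_def)
  also have "r dvd n \<and> int (n div r) * s = m \<longleftrightarrow> s * m \<ge> 0 \<and> n = r * nat (s * m)"
    using assms by (auto simp: nat_mult_distrib)
  finally show "fps_nth (zcoeff m (fps_recip (1 - fps_const (Poly_Mapping.single s 1) * qq ^ r))) n =
      fps_nth (if s * m \<ge> 0 then fps_X ^ (r * nat (s * m)) else 0) n"
    by (simp add: fps_X_power_nth)
qed

text \<open>
  From the partial fractions \<open>(1 - x\<^sup>2)/((1 - zx)(1 - x/z)) = 1/(1 - zx) + 1/(1 - x/z) - 1\<close>.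
\<close>
lemma zcoeff_recip_z_factor:
  assumes "r > 0"
  shows "zcoeff m (recip_z_factor r) = fps_recip (1 - fps_X ^ (2 * r)) * fps_X ^ (r * nat \<bar>m\<bar>)"
proof -
  define a b where "a = fps_recip (1 - zz * qq ^ r)" and "b = fps_recip (1 - zz_inv * qq ^ r)"
  define x where "x = qq ^ r"
  have a: "(1 - zz * x) * a = 1" and b: "(1 - zz_inv * x) * b = 1"
    unfolding a_def b_def x_def using assms by (simp_all add: fps_mult_recip)
  have "(1 - zz_inv * x) + zz_inv * x * (1 - zz * x) = 1 - x * x"
    using zz_mult_zz_inv by (simp add: algebra_simps)
  then have "(1 - x * x) * (a * b) = ((1 - zz_inv * x) * b) * a + zz_inv * x * (((1 - zz * x) * a) * b)"
    by (metis (no_types, lifting) distrib_right mult.assoc mult.commute)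
  also have "\<dots> = a + zz_inv * x * b"
    by (simp only: a b mult_1_left)
  also have "zz_inv * x * b = b - 1"
    using b by (simp add: algebra_simps)
  finally have "(1 - x * x) * recip_z_factor r = a + (b - 1)"
    by (simp add: recip_z_factor_def a_def b_def)
  then have "recip_z_factor r - qq ^ (2 * r) * recip_z_factor r = a + (b - 1)"
    by (simp add: x_def left_diff_distrib mult_2 power_add)
  from arg_cong[OF this, of "zcoeff m"]
  have "zcoeff m (recip_z_factor r) - fps_X ^ (2 * r) * zcoeff m (recip_z_factor r) = zcoeff m a + (zcoeff m b - zcoeff m 1)"
    unfolding zcoeff_add zcoeff_diff zcoeff_X_power_mult .
  also have "\<dots> = fps_X ^ (r * nat \<bar>m\<bar>)"
  proof -
    have "zcoeff m 1 = (if m = 0 then 1 else 0)"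
      by (rule fps_ext) (simp add: zcoeff_nth lookup_one when_def)
    then show ?thesis
      using zcoeff_geometric[OF assms, of 1 m] zcoeff_geometric[OF assms, of "-1" m]
      by (auto simp: a_def b_def zz_def zz_inv_def)
  qed
  finally have *: "(1 - fps_X ^ (2 * r)) * zcoeff m (recip_z_factor r) = fps_X ^ (r * nat \<bar>m\<bar>)"
    by (simp add: left_diff_distrib)
  have "fps_recip (1 - fps_X ^ (2 * r)) * ((1 - fps_X ^ (2 * r)) * zcoeff m (recip_z_factor r)) = zcoeff m (recip_z_factor r)"
    using fps_mult_recip[of "1 - fps_X ^ (2 * r) :: int fps"] assms by (simp add: mult_ac)
  then show ?thesis
    unfolding * by simp
qed

lemma zcoeff_C1_gf_cong:
  "fps_cong (Suc M) (qfact (fps_X ^ 2) (Suc M) * zcoeff m C1_gf)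
     (\<Sum>r=1..M. bailey_alpha fps_X r * (fps_X ^ (r * Suc (nat \<bar>m\<bar>)) * fps_recip (1 - fps_X ^ (2 * r))))"
proof -
  have "fps_cong (Suc M) (zcoeff m (qfact (qq ^ 2) (Suc M) * C1_gf))
      (zcoeff m (\<Sum>r=1..M. bailey_alpha qq r * (qq ^ r * recip_z_factor r)))"
    using C1_gf_cong[of M] by (simp add: fps_cong_iff zcoeff_nth)
  moreover have "zcoeff m (\<Sum>r=1..M. bailey_alpha qq r * (qq ^ r * recip_z_factor r)) =
      (\<Sum>r=1..M. bailey_alpha fps_X r * (fps_X ^ (r * Suc (nat \<bar>m\<bar>)) * fps_recip (1 - fps_X ^ (2 * r))))"
    unfolding zcoeff_sum
  proof (intro sum.cong refl)
    fix r assume "r \<in> {1..M}"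
    then have "r > 0" by simp
    show "zcoeff m (bailey_alpha qq r * (qq ^ r * recip_z_factor r)) =
        bailey_alpha fps_X r * (fps_X ^ (r * Suc (nat \<bar>m\<bar>)) * fps_recip (1 - fps_X ^ (2 * r)))"
      unfolding zcoeff_bailey_alpha_mult zcoeff_X_power_mult zcoeff_recip_z_factor[OF \<open>r > 0\<close>] mult_Suc_right power_add
      by (simp only: mult_ac)
  qed
  ultimately show ?thesis
    unfolding zcoeff_qfact_mult by simp
qed

section \<open>Power series with nonnegative coefficients\<close>

definition fps_nonneg :: "int fps \<Rightarrow> bool" where
  "fps_nonneg f \<longleftrightarrow> (\<forall>n. fps_nth f n \<ge> 0)"

lemma fps_nonneg_diffD: "fps_nonneg (f - g) \<Longrightarrow> fps_nth g n \<le> fps_nth f n"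
  by (simp add: fps_nonneg_def)

lemma fps_nonneg_add: "fps_nonneg f \<Longrightarrow> fps_nonneg g \<Longrightarrow> fps_nonneg (f + g)"
  by (simp add: fps_nonneg_def)

lemma fps_nonneg_mult: "fps_nonneg f \<Longrightarrow> fps_nonneg g \<Longrightarrow> fps_nonneg (f * g)"
  by (simp add: fps_nonneg_def fps_mult_nth sum_nonneg)

lemma fps_nonneg_sum: "(\<And>x. x \<in> A \<Longrightarrow> fps_nonneg (f x)) \<Longrightarrow> fps_nonneg (sum f A)"
  by (simp add: fps_nonneg_def fps_sum_nth sum_nonneg)

lemma fps_nonneg_X_power: "fps_nonneg (fps_X ^ k)"
  by (simp add: fps_nonneg_def)

lemma fps_nonneg_sum_diff_member:
  assumes "finite A" "x \<in> A" "\<And>y. y \<in> A \<Longrightarrow> fps_nonneg (f y)" "fps_nonneg (f x - g)"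
  shows "fps_nonneg (sum f A - g)"
proof -
  have eq: "sum f A - g = (f x - g) + sum f (A - {x})"
    using assms(1,2) by (simp add: sum.remove)
  show ?thesis
    unfolding eq using assms(3,4) by (auto intro!: fps_nonneg_add fps_nonneg_sum)
qed

definition geom :: "nat \<Rightarrow> int fps" where
  "geom k = fps_recip (1 - fps_X ^ k)"

lemma geom_inverse: "k > 0 \<Longrightarrow> (1 - fps_X ^ k) * geom k = 1"
  unfolding geom_def by (rule fps_mult_recip) simp

lemma geom_nth: "k > 0 \<Longrightarrow> fps_nth (geom k) n = (if k dvd n then 1 else 0)"
  using recip_one_minus_const_X_power[of k "1 :: int"] by (simp add: geom_def)

lemma fps_nonneg_geom: "k > 0 \<Longrightarrow> fps_nonneg (geom k)"
  by (simp add: fps_nonneg_def geom_nth)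

lemma geom_double: 
  assumes "k > 0"
  shows "(1 + fps_X ^ k) * geom (2 * k) = geom k"
proof -
  have "(1 - x) * ((1 + x) * y) = (1 - x * x) * y" for x y :: "int fps"
    by (simp add: algebra_simps)
  then have "(1 - fps_X ^ k) * ((1 + fps_X ^ k) * geom (2 * k)) = (1 - fps_X ^ (2 * k)) * geom (2 * k)"
    unfolding mult_2[of k] power_add .
  also have "\<dots> = 1"
    using assms by (intro geom_inverse) simp
  finally show ?thesis
    unfolding geom_def[of k] using assms by (intro recip_eqI[symmetric]) auto
qed

lemma truncated_geom:
  assumes "k > 0"
  shows "(fps_X ^ s - fps_X ^ (s + k * t)) * geom k = (\<Sum>i<t. fps_X ^ (s + k * i))"
proof -
  have eq: "(1 - fps_X ^ k) * (\<Sum>i<t. fps_X ^ (s + k * i)) = fps_X ^ s - (fps_X :: int fps) ^ (s + k * t)"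
  proof (induction t)
    case (Suc t)
    have "(1 - fps_X ^ k) * (\<Sum>i<Suc t. (fps_X :: int fps) ^ (s + k * i)) =
        (1 - fps_X ^ k) * (\<Sum>i<t. fps_X ^ (s + k * i)) + (fps_X ^ (s + k * t) - fps_X ^ k * fps_X ^ (s + k * t))"
      by (simp add: distrib_left left_diff_distrib)
    also have "(fps_X :: int fps) ^ k * fps_X ^ (s + k * t) = fps_X ^ (s + k * Suc t)"
      by (simp add: ac_simps flip: power_add)
    finally show ?case
      unfolding Suc.IH by simp
  qed simp
  have "(fps_X ^ s - fps_X ^ (s + k * t)) * geom k = ((1 - fps_X ^ k) * geom k) * (\<Sum>i<t. fps_X ^ (s + k * i))"
    unfolding eq[symmetric] by (simp only: mult_ac)
  then show ?thesis
    by (simp add: geom_inverse[OF assms])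
qed

section \<open>Cancellation between the geometric progressions\<close>

definition bailey_term :: "nat \<Rightarrow> nat \<Rightarrow> int fps" where
  "bailey_term m r = bailey_alpha fps_X r * (fps_X ^ (r * Suc m) * geom (2 * r))"

text \<open>
  The term of index \<open>r = 2i + 1\<close> that comes from the unit pair. Its positive progression has step \<open>r\<close>,
  not \<open>2r\<close>, and so contains exponents of both parities.
\<close>
definition odd_term :: "nat \<Rightarrow> nat \<Rightarrow> int fps" where
  "odd_term m i = fps_X ^ ((2 * i + 1) * (i + 1 + m)) * geom (2 * i + 1)"

text \<open>
  The term of index \<open>2j\<close>, where both sequences contribute: a progression with alternating sign from
  C(1) and a negative one from the unit pair, each with step \<open>2j\<close>.
\<close>
definition even_term :: "nat \<Rightarrow> nat \<Rightarrow> int fps" where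
  "even_term m j = ((-1) ^ j * fps_X ^ (j * (3 * j + 1 + 2 * m)) - fps_X ^ (j * (2 * j + 1 + 2 * m))) * geom (2 * j)"

lemma bailey_term_odd: "bailey_term m (2 * i + 1) = odd_term m i"
proof -
  define r where "r = 2 * i + 1"
  have r: "odd r" "r > 0" by (simp_all add: r_def)
  have e: "r * (r - 1) div 2 + r * Suc m = r * (i + 1 + m)"
    by (simp add: r_def algebra_simps)
  have "bailey_term m r = (fps_X ^ (r * (r - 1) div 2) * fps_X ^ (r * Suc m)) * ((1 + fps_X ^ r) * geom (2 * r))"
    using r(1) unfolding bailey_term_def bailey_alpha_def bailey_alpha_C1_def bailey_alpha_unit_def
    by (simp add: mult_ac)
  also have "\<dots> = fps_X ^ (r * (i + 1 + m)) * geom r"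
    unfolding geom_double[OF r(2)] power_add[symmetric] e by (rule refl)
  finally show ?thesis
    by (simp add: odd_term_def r_def)
qed

lemma bailey_term_even:
  assumes "j > 0"
  shows "bailey_term m (2 * j) = even_term m j"
proof -
  define r where "r = 2 * j"
  have r: "even r" "r > 0" "r div 2 = j" using assms by (simp_all add: r_def)
  obtain i where j: "j = Suc i" using assms by (metis gr0_implies_Suc)
  have e: "j * (3 * j - 1) + r * Suc m = j * (3 * j + 1 + 2 * m)" "r * (r - 1) div 2 + r * Suc m = j * (2 * j + 1 + 2 * m)"
    by (simp_all add: r_def j algebra_simps)
  have "bailey_term m r = ((-1) ^ j * (fps_X ^ (j * (3 * j - 1)) * fps_X ^ (r * Suc m)) -
      fps_X ^ (r * (r - 1) div 2) * fps_X ^ (r * Suc m)) * ((1 + fps_X ^ r) * geom (2 * r))"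
    using r(1) unfolding bailey_term_def bailey_alpha_def bailey_alpha_C1_def bailey_alpha_unit_def r(3)
    by (simp add: algebra_simps)
  also have "\<dots> = even_term m j"
    unfolding geom_double[OF r(2)] power_add[symmetric] e by (simp add: even_term_def r_def)
  finally show ?thesis
    by (simp add: r_def)
qed

text \<open>
  An index \<open>2i + 1\<close> is grouped with \<open>2(2i + 1)\<close>, which has the same step up to a factor 2, and with
  \<open>2(2i + 2)\<close>, whose negative terms the former two have to absorb. The even indices up to \<open>4K\<close> use up the
  odd ones below \<open>2K\<close>; the remaining odd ones are nonnegative.
\<close>
lemma bailey_term_sum:
  "(\<Sum>r=1..4*K. bailey_term m r) =
     (\<Sum>i<K. odd_term m i + even_term m (2 * i + 1) + even_term m (2 * i + 2)) + (\<Sum>i=K..<2*K. odd_term m i)"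
proof -
  have "(\<Sum>r=1..4*K. bailey_term m r) = (\<Sum>i<2*K. odd_term m i + even_term m (Suc i))"
    using sum_pairs[of "bailey_term m" "2 * K"] bailey_term_even[of "Suc _" m]
    by (simp add: bailey_term_odd[simplified])
  also have "\<dots> = (\<Sum>i<2*K. odd_term m i) + (\<Sum>j=1..2*K. even_term m j)"
    by (simp add: sum.distrib sum.atLeast1_atMost_eq)
  also have "(\<Sum>i<2*K. odd_term m i) = (\<Sum>i<K. odd_term m i) + (\<Sum>i=K..<2*K. odd_term m i)"
    using sum.atLeastLessThan_concat[of 0 K "2 * K" "odd_term m"] by (simp add: lessThan_atLeast0)
  also have "(\<Sum>j=1..2*K. even_term m j) = (\<Sum>i<K. even_term m (2 * i + 1) + even_term m (2 * i + 2))"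
    by (rule sum_pairs)
  finally show ?thesis
    by (simp add: sum.distrib algebra_simps)
qed

text \<open>
  What is left of the progressions with odd exponents at index \<open>r = 2i + 1\<close>.
\<close>
definition odd_part :: "nat \<Rightarrow> nat \<Rightarrow> int fps" where
  "odd_part m i = (let r = 2 * i + 1; v = (i + 1 + m) div 2 in
     \<Sum>k<r + m - v. fps_X ^ (2 * r * v + r + 2 * r * k))"

text \<open>
  The even exponents at index \<open>r = 2i + 1\<close> that remain after the first \<open>i + 1\<close> have been matched with
  the negative terms of index \<open>2i + 2\<close>.
\<close>
definition even_rest :: "nat \<Rightarrow> nat \<Rightarrow> int fps" where
  "even_rest m i = (let r = 2 * i + 1; u = (i + 2 + m) div 2 + Suc i in
     \<Sum>k<3 * i + 2 + m - u. fps_X ^ (2 * r * u + 2 * r * k))"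

text \<open>
  The quotient by \<open>1 - q\<^sup>2\<close> of the \<open>i + 1\<close> matched pairs: the pair \<open>q\<^sup>2\<^sup>s - q\<^sup>2\<^sup>t\<close> contributes
  the even powers of \<open>q\<close> from \<open>q\<^sup>2\<^sup>s\<close> up to, but excluding, \<open>q\<^sup>2\<^sup>t\<close>.
\<close>
definition even_surplus :: "nat \<Rightarrow> nat \<Rightarrow> int fps" where
  "even_surplus m i = (\<Sum>k<Suc i.
     \<Sum>t=(2 * i + 1) * ((i + 2 + m) div 2 + k)..<Suc i * (4 * i + 5 + 2 * m + 2 * k). fps_X ^ (2 * t))"

text \<open>
  Put \<open>r = 2i + 1\<close>. The exponents \<open>r(i+1+m)\<close> and \<open>r(i+2+m)\<close> are an even one, \<open>2ru\<close>, and an odd one,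
  \<open>2rv + r\<close>, in some order. The negative progressions with step \<open>2r\<close> start at an even and an odd
  exponent that are larger and congruent to these modulo \<open>2r\<close>, so they cut off the tails of the positive
  ones. For \<open>l = 2i + 2\<close> the two progressions with step \<open>2l\<close> start at distance \<open>l\<^sup>2\<close>, which leaves \<open>i + 1\<close>
  negative terms. The \<open>k\<close>-th of these has a larger exponent than the \<open>k\<close>-th positive even term.
\<close>
lemma three_terms_decomposition:
  "odd_term m i + even_term m (2 * i + 1) + even_term m (2 * i + 2) =
     odd_part m i + even_rest m i + (1 - fps_X ^ 2) * even_surplus m i"
proof -
  define r where "r = 2 * i + 1"
  define l where "l = 2 * i + 2"
  define u where "u = (i + 2 + m) div 2"
  define v where "v = (i + 1 + m) div 2"
  have r: "r > 0" "2 * r > 0" and l: "l > 0" "2 * l > 0" by (simp_all add: r_def l_def)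
  have bounds: "u + Suc i \<le> 3 * i + 2 + m" "v \<le> r + m"
    by (simp_all add: u_def v_def r_def)
  have double: "2 * r * k = r * (2 * k)" for k
    by simp
  have starts: "fps_X ^ (r * (i + 1 + m)) * (1 + fps_X ^ r) = fps_X ^ (2 * r * u) + (fps_X :: int fps) ^ (2 * r * v + r)"
  proof (cases "even (i + 1 + m)")
    case True
    then have "2 * u = i + 1 + m" "2 * v = i + 1 + m"
      unfolding u_def v_def by presburger+
    then have "2 * r * u = r * (i + 1 + m)" "2 * r * v = r * (i + 1 + m)"
      unfolding double by simp_all
    then show ?thesis by (simp add: distrib_left power_add)
  next
    case False
    then have "2 * u = i + 1 + m + 1" "2 * v + 1 = i + 1 + m"
      unfolding u_def v_def by presburger+
    then have "2 * r * u = r * (i + 1 + m) + r" "2 * r * v + r = r * (i + 1 + m)"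
      unfolding double by (simp, metis distrib_left mult_1_right)
    then show ?thesis by (simp add: distrib_left power_add)
  qed
  have c: "r * (3 * r + 1 + 2 * m) = 2 * r * (u + Suc i) + 2 * r * (3 * i + 2 + m - (u + Suc i))"
    "r * (3 * r + 1 + 2 * m) = 2 * r * (3 * i + 2 + m)"
    using bounds(1) unfolding distrib_left[symmetric] mult.assoc by (simp_all add: r_def algebra_simps)
  have b: "r * (2 * r + 1 + 2 * m) = (2 * r * v + r) + 2 * r * (r + m - v)"
  proof -
    have "r * (2 * r + 1 + 2 * m) = 2 * r * (v + (r + m - v)) + r"
      using bounds(2) by (simp add: algebra_simps)
    then show ?thesis by (simp add: algebra_simps)
  qed
  have "odd_term m i + even_term m r =
      (fps_X ^ (r * (i + 1 + m)) * (1 + fps_X ^ r) - fps_X ^ (r * (3 * r + 1 + 2 * m)) - fps_X ^ (r * (2 * r + 1 + 2 * m))) * geom (2 * r)"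
  proof -
    have "odd_term m i = fps_X ^ (r * (i + 1 + m)) * ((1 + fps_X ^ r) * geom (2 * r))"
      unfolding odd_term_def r_def[symmetric] geom_double[OF r(1)] by (rule refl)
    moreover have "odd r" by (simp add: r_def)
    ultimately show ?thesis
      by (simp add: even_term_def algebra_simps)
  qed
  also have "\<dots> = (fps_X ^ (2 * r * v + r) - fps_X ^ (r * (2 * r + 1 + 2 * m))) * geom (2 * r)
     + (fps_X ^ (2 * r * u) - fps_X ^ (2 * r * u + 2 * r * Suc i)) * geom (2 * r)
     + (fps_X ^ (2 * r * (u + Suc i)) - fps_X ^ (r * (3 * r + 1 + 2 * m))) * geom (2 * r)"
    unfolding starts by (simp add: algebra_simps)
  also have "\<dots> = odd_part m i + (\<Sum>k<Suc i. fps_X ^ (2 * r * u + 2 * r * k)) + even_rest m i"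
    unfolding b c(1) truncated_geom[OF r(2)] unfolding odd_part_def even_rest_def Let_def r_def[symmetric] u_def[symmetric] v_def[symmetric]
    by (rule refl)
  finally have odd_index: "odd_term m i + even_term m r = \<dots>" .
  have "even_term m l = - ((fps_X ^ (l * (2 * l + 1 + 2 * m)) - fps_X ^ (l * (2 * l + 1 + 2 * m) + 2 * l * Suc i)) * geom (2 * l))"
  proof -
    have "l * (3 * l + 1 + 2 * m) = l * (2 * l + 1 + 2 * m) + 2 * l * Suc i" "even l"
      by (simp_all add: l_def algebra_simps)
    then show ?thesis
      unfolding even_term_def by (simp add: algebra_simps)
  qed
  also have "\<dots> = - (\<Sum>k<Suc i. fps_X ^ (l * (2 * l + 1 + 2 * m) + 2 * l * k))"
    unfolding truncated_geom[OF l(2)] by (rule refl)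
  finally have even_index: "even_term m l = \<dots>" .
  \<comment> \<open>The \<open>k\<close>-th positive even term against the \<open>k\<close>-th negative one.\<close>
  have gap: "fps_X ^ (2 * r * u + 2 * r * k) - fps_X ^ (l * (2 * l + 1 + 2 * m) + 2 * l * k) =
      (1 - fps_X ^ 2) * (\<Sum>t=r * (u + k)..<Suc i * (4 * i + 5 + 2 * m + 2 * k). (fps_X :: int fps) ^ (2 * t))" for k
  proof -
    have telescope: "(1 - fps_X ^ 2) * (\<Sum>t=a..<d. (fps_X :: int fps) ^ (2 * t)) = fps_X ^ (2 * a) - fps_X ^ (2 * d)"
      if "a \<le> d" for a d
      using that
    proof (induction d rule: dec_induct)
      case (step d)
      have "(1 - fps_X ^ 2) * (\<Sum>t=a..<Suc d. (fps_X :: int fps) ^ (2 * t)) =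
          (1 - fps_X ^ 2) * (\<Sum>t=a..<d. fps_X ^ (2 * t)) + (fps_X ^ (2 * d) - fps_X ^ 2 * fps_X ^ (2 * d))"
        using step.hyps by (simp only: sum.atLeastLessThan_Suc distrib_left left_diff_distrib mult_1_left)
      also have "(fps_X :: int fps) ^ 2 * fps_X ^ (2 * d) = fps_X ^ (2 * Suc d)"
        by (simp flip: power_add)
      finally show ?case
        unfolding step.IH by simp
    qed simp
    have "r * (u + k) \<le> (2 * Suc i) * (u + k)"
      by (intro mult_right_mono) (simp_all add: r_def)
    also have "(2 * Suc i) * (u + k) = Suc i * (2 * u + 2 * k)"
      by (simp add: algebra_simps)
    also have "\<dots> \<le> Suc i * (4 * i + 5 + 2 * m + 2 * k)"
      by (intro mult_left_mono) (simp_all add: u_def)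
    finally have "r * (u + k) \<le> Suc i * (4 * i + 5 + 2 * m + 2 * k)" .
    moreover have "2 * (r * (u + k)) = 2 * r * u + 2 * r * k"
      by (simp add: algebra_simps)
    moreover have "2 * (Suc i * (4 * i + 5 + 2 * m + 2 * k)) = l * (2 * l + 1 + 2 * m) + 2 * l * k"
      by (simp add: l_def algebra_simps)
    ultimately show ?thesis
      using telescope by metis
  qed
  have paired: "(\<Sum>k<Suc i. fps_X ^ (2 * r * u + 2 * r * k)) - (\<Sum>k<Suc i. fps_X ^ (l * (2 * l + 1 + 2 * m) + 2 * l * k)) =
      (1 - fps_X ^ 2) * even_surplus m i"
    unfolding sum_subtractf[symmetric] gap even_surplus_def sum_distrib_left[symmetric] r_def[symmetric] u_def[symmetric]
    by (rule refl)
  have regroup: "a + b + c + - d = a + c + (b - d)" for a b c d :: "int fps"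
    by simp
  show ?thesis
    unfolding r_def[symmetric] l_def[symmetric] odd_index even_index regroup paired by (rule refl)
qed

section \<open>Positivity\<close>

text \<open>
  The generating function of the partitions into even parts between \<open>2a\<close> and \<open>2T\<close>.
\<close>
definition even_partitions_from :: "nat \<Rightarrow> nat \<Rightarrow> int fps" where
  "even_partitions_from a T = (\<Prod>k=a..T. geom (2 * k))"

lemma even_partitions_from_ge_1:
  assumes "a > 0"
  shows "fps_nonneg (even_partitions_from a T)" "fps_nonneg (even_partitions_from a T - 1)"
proof -
  have *: "fps_nonneg (prod f A) \<and> fps_nonneg (prod f A - 1)"
    if "finite A" "\<And>k. k \<in> A \<Longrightarrow> fps_nonneg (f k) \<and> fps_nonneg (f k - 1)" for f and A :: "nat set"
    using that
  proof (induction A rule: finite_induct)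
    case empty
    show ?case by (simp add: fps_nonneg_def)
  next
    case (insert k A)
    have eq: "prod f (insert k A) - 1 = f k * (prod f A - 1) + (f k - 1)" "prod f (insert k A) = f k * prod f A"
      using insert.hyps by (simp_all add: algebra_simps)
    have "fps_nonneg (prod f (insert k A) - 1)"
      unfolding eq(1) using insert by (auto intro!: fps_nonneg_mult fps_nonneg_add)
    moreover have "fps_nonneg (prod f (insert k A))"
      unfolding eq(2) using insert by (auto intro!: fps_nonneg_mult)
    ultimately show ?case
      by (rule conjI[rotated])
  qed
  have "fps_nonneg (geom (2 * k)) \<and> fps_nonneg (geom (2 * k) - 1)" if "k \<in> {a..T}" for k
    using that assms by (auto simp: fps_nonneg_def geom_nth)
  from *[of "{a..T}" "\<lambda>k. geom (2 * k)", OF finite_atLeastAtMost this] show "fps_nonneg (even_partitions_from a T)" "fps_nonneg (even_partitions_from a T - 1)"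
    unfolding even_partitions_from_def by auto
qed

lemma even_partitions_from_Suc:
  "a \<le> T \<Longrightarrow> even_partitions_from a T = geom (2 * a) * even_partitions_from (Suc a) T"
  unfolding even_partitions_from_def by (rule prod.atLeast_Suc_atMost)

lemma even_partitions_from_ge_geom:
  assumes "0 < a" "a \<le> T"
  shows "fps_nonneg (even_partitions_from a T - geom (2 * a))"
proof -
  have "even_partitions_from a T - geom (2 * a) = geom (2 * a) * (even_partitions_from (Suc a) T - 1)"
    using assms(2) by (simp add: even_partitions_from_Suc algebra_simps)
  then show ?thesis
    using assms by (auto intro!: fps_nonneg_mult fps_nonneg_geom even_partitions_from_ge_1)
qed

lemma qfact_mult_even_partitions: "qfact (fps_X ^ 2) T * even_partitions_from 1 T = 1"
proof -
  have "qfact (fps_X ^ 2) T * even_partitions_from 1 T = (\<Prod>k=1..T. (1 - (fps_X ^ 2) ^ k) * geom (2 * k))"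
    by (simp add: qfact_def even_partitions_from_def prod.distrib)
  also have "\<dots> = (\<Prod>k=1..T. 1)"
    by (rule prod.cong) (simp_all add: geom_inverse flip: power_mult)
  finally show ?thesis by simp
qed

text \<open>
  Multiplying by \<open>1 - q\<^sup>2\<close> removes the part 2 from the partitions, so the term \<open>(1 - q\<^sup>2) Q\<close> keeps
  nonnegative coefficients after the division by \<open>(q\<^sup>2;q\<^sup>2)\<^sub>\<infinity>\<close>.
\<close>
lemma zcoeff_decomposition:
  assumes "n \<le> 4 * K" "K > 0"
  defines "T \<equiv> 4 * K + 1"
  obtains P Q where
    "fps_nth (zcoeff m C1_gf) n = fps_nth (even_partitions_from 1 T * P + even_partitions_from 2 T * Q) n"
    "fps_nonneg (P - odd_part (nat \<bar>m\<bar>) 0)" "fps_nonneg (Q - even_surplus (nat \<bar>m\<bar>) 0)"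
proof
  define m' where "m' = nat \<bar>m\<bar>"
  define P where "P = (\<Sum>i<K. odd_part m' i + even_rest m' i) + (\<Sum>i=K..<2*K. odd_term m' i)"
  define Q where "Q = (\<Sum>i<K. even_surplus m' i)"
  define G where "G = even_partitions_from 1 T"
  have nonneg: "fps_nonneg (odd_part m' i)" "fps_nonneg (even_rest m' i)" "fps_nonneg (even_surplus m' i)" "fps_nonneg (odd_term m' i)" for i
    unfolding odd_part_def even_rest_def even_surplus_def odd_term_def Let_def
    by (intro fps_nonneg_sum fps_nonneg_X_power fps_nonneg_mult fps_nonneg_geom; simp)+
  have F: "(\<Sum>r=1..4*K. bailey_term m' r) = P + (1 - fps_X ^ 2) * Q"
    unfolding bailey_term_sum three_terms_decomposition P_def Q_def sum.distrib sum_distrib_left by (simp only: add_ac)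
  have "fps_cong (Suc (4 * K)) (qfact (fps_X ^ 2) T * zcoeff m C1_gf) (\<Sum>r=1..4*K. bailey_term m' r)"
    using zcoeff_C1_gf_cong[of "4 * K" m] by (simp add: bailey_term_def geom_def m'_def T_def)
  from fps_cong_mult[OF fps_cong_refl[of _ G] this]
  have "fps_cong (Suc (4 * K)) ((qfact (fps_X ^ 2) T * G) * zcoeff m C1_gf) (G * (P + (1 - fps_X ^ 2) * Q))"
    unfolding F by (simp only: mult_ac)
  moreover have "(1 - fps_X ^ 2) * G = even_partitions_from 2 T"
  proof -
    have "G = geom 2 * even_partitions_from 2 T"
      using even_partitions_from_Suc[of 1 T] by (simp add: G_def T_def numeral_2_eq_2)
    then have "(1 - fps_X ^ 2) * G = ((1 - fps_X ^ 2) * geom 2) * even_partitions_from 2 T"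
      by (simp only: mult_ac)
    then show ?thesis by (simp add: geom_inverse)
  qed
  ultimately have "fps_cong (Suc (4 * K)) (zcoeff m C1_gf) (G * P + even_partitions_from 2 T * Q)"
    unfolding G_def qfact_mult_even_partitions by (simp add: distrib_left mult_ac)
  then show "fps_nth (zcoeff m C1_gf) n = fps_nth (even_partitions_from 1 T * P + even_partitions_from 2 T * Q) n"
    using assms(1) by (simp add: fps_cong_iff G_def)
  show "fps_nonneg (Q - even_surplus (nat \<bar>m\<bar>) 0)"
    unfolding Q_def m'_def[symmetric] using assms(2) nonneg
    by (intro fps_nonneg_sum_diff_member[of _ 0]) (simp_all add: fps_nonneg_def)
  have "fps_nonneg ((\<Sum>i<K. odd_part m' i + even_rest m' i) - odd_part m' 0)"
    using assms(2) nonneg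
    by (intro fps_nonneg_sum_diff_member[of _ 0]) (simp_all add: fps_nonneg_add)
  from fps_nonneg_add[OF this fps_nonneg_sum[of "{K..<2*K}" "odd_term m'"]]
  show "fps_nonneg (P - odd_part (nat \<bar>m\<bar>) 0)"
    unfolding P_def m'_def[symmetric] using nonneg by (simp add: algebra_simps)
qed

text \<open>
  For odd \<open>n\<close>, a single odd power of \<open>q\<close> in \<open>P\<close> suffices, since the parts 2 fill up the rest. For even
  \<open>n\<close>, the part 2 is not available with \<open>Q\<close>; but \<open>Q\<close> contains two consecutive even powers of \<open>q\<close>, and
  parts 4 fill up the rest from one of them.
\<close>
lemma N_C1_pos:
  assumes "n \<ge> nat \<bar>m\<bar> + 2"
  shows "N_C1 m n > 0"
proof -
  define m' where "m' = nat \<bar>m\<bar>"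
  define T where "T = 4 * Suc n + 1"
  define v where "v = (1 + m') div 2"
  define u where "u = (2 + m') div 2"
  obtain P Q where
    PQ: "fps_nth (zcoeff m C1_gf) n = fps_nth (even_partitions_from 1 T * P + even_partitions_from 2 T * Q) n"
    and P: "fps_nonneg (P - odd_part m' 0)" and Q: "fps_nonneg (Q - even_surplus m' 0)"
    using zcoeff_decomposition[of n "Suc n" m] unfolding T_def m'_def by auto
  have "fps_nonneg (odd_part m' 0 - fps_X ^ (2 * v + 1))"
    unfolding odd_part_def Let_def
    by (intro fps_nonneg_sum_diff_member[of _ 0]) (auto simp: fps_nonneg_X_power v_def fps_nonneg_def)
  from fps_nonneg_add[OF P this] have P': "fps_nonneg (P - fps_X ^ (2 * v + 1))"
    by simp
  have "even_surplus m' 0 = (\<Sum>t=u..<5 + 2 * m'. fps_X ^ (2 * t))"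
    by (simp add: even_surplus_def u_def)
  also have "\<dots> = fps_X ^ (2 * u) + (fps_X ^ (2 * u + 2) + (\<Sum>t=Suc (Suc u)..<5 + 2 * m'. fps_X ^ (2 * t)))"
    by (subst sum.atLeast_Suc_lessThan, simp add: u_def, subst sum.atLeast_Suc_lessThan) (simp_all add: u_def)
  finally have "fps_nonneg (even_surplus m' 0 - (fps_X ^ (2 * u) + fps_X ^ (2 * u + 2)))"
    by (auto intro!: fps_nonneg_sum fps_nonneg_X_power simp: algebra_simps)
  from fps_nonneg_add[OF Q this] have Q': "fps_nonneg (Q - (fps_X ^ (2 * u) + fps_X ^ (2 * u + 2)))"
    by (simp only: add_diff_eq diff_add_cancel)
  have mono: "fps_nonneg (a * b - a' * b')" if "fps_nonneg a'" "fps_nonneg b" "fps_nonneg (a - a')" "fps_nonneg (b - b')" for a b a' b'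
  proof -
    have "a * b - a' * b' = (a - a') * b + a' * (b - b')"
      by (simp add: algebra_simps)
    then show ?thesis using that by (simp add: fps_nonneg_add fps_nonneg_mult)
  qed
  have nnP: "fps_nonneg P" and nnQ: "fps_nonneg Q"
    using fps_nonneg_add[OF P' fps_nonneg_X_power[of "2 * v + 1"]]
      fps_nonneg_add[OF Q' fps_nonneg_add[OF fps_nonneg_X_power[of "2 * u"] fps_nonneg_X_power[of "2 * u + 2"]]]
    by simp_all
  have "fps_nonneg (even_partitions_from 1 T * P - geom 2 * fps_X ^ (2 * v + 1))"
    using even_partitions_from_ge_geom[of 1 T] by (intro mono fps_nonneg_geom nnP P') (simp_all add: T_def)
  moreover have "fps_nonneg (even_partitions_from 2 T * Q - geom 4 * (fps_X ^ (2 * u) + fps_X ^ (2 * u + 2)))"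
    using even_partitions_from_ge_geom[of 2 T] by (intro mono fps_nonneg_geom nnQ Q') (simp_all add: T_def)
  ultimately have "fps_nth (zcoeff m C1_gf) n \<ge>
      fps_nth (geom 2 * fps_X ^ (2 * v + 1)) n + fps_nth (geom 4 * (fps_X ^ (2 * u) + fps_X ^ (2 * u + 2))) n"
    unfolding PQ fps_add_nth[of "even_partitions_from 1 T * P"] by (intro add_mono fps_nonneg_diffD)
  also have "fps_nth (geom 2 * fps_X ^ (2 * v + 1)) n + fps_nth (geom 4 * (fps_X ^ (2 * u) + fps_X ^ (2 * u + 2))) n =
     (if 2 * v + 1 \<le> n \<and> 2 dvd n - (2 * v + 1) then 1 else 0) +
     ((if 2 * u \<le> n \<and> 4 dvd n - 2 * u then 1 else 0) + (if 2 * u + 2 \<le> n \<and> 4 dvd n - (2 * u + 2) then 1 else 0))"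
    unfolding distrib_left fps_add_nth fps_X_power_mult_right_nth geom_nth[OF zero_less_numeral] by auto
  finally have bound: "fps_nth (zcoeff m C1_gf) n \<ge> \<dots>" .
  have "2 * v + 1 \<le> n" "2 * u \<le> n"
    using assms unfolding u_def v_def m'_def by linarith+
  have "(2 * v + 1 \<le> n \<and> 2 dvd n - (2 * v + 1)) \<or> (2 * u \<le> n \<and> 4 dvd n - 2 * u) \<or> (2 * u + 2 \<le> n \<and> 4 dvd n - (2 * u + 2))"
  proof (cases "even n")
    case False
    then show ?thesis
      using \<open>2 * v + 1 \<le> n\<close> by simp
  next
    case True
    then obtain k where k: "n = 2 * k"
      by (rule evenE)
    define d where "d = k - u"
    have d: "n = 2 * (u + d)"
      using \<open>2 * u \<le> n\<close> by (simp add: k d_def)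
    show ?thesis
    proof (cases "even d")
      case True
      then show ?thesis
        unfolding d by (auto elim!: evenE)
    next
      case False
      then show ?thesis
        unfolding d by (auto elim!: oddE)
    qed
  qed
  with bound show ?thesis
    unfolding N_C1_def zcoeff_nth by (auto split: if_splits)
qed

theorem corollary1p2:
  fixes m :: int
  shows "\<exists>n\<^sub>0::nat. \<forall>n\<ge>n\<^sub>0. N_C1 m n > 0"
  using N_C1_pos by blast

end
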